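(* Let $G$ be a finite group with $|C(G)|=\frac{|G|}{2}-1$. Then the following hold. (1) $\mathcal{O}_{2}(G)=1$ if and only if $G\cong\mathbb{Z}_{10}$ or $G\cong$ SmallGroup$[20,1]$ ($\mathbb{Z}_{5}\rtimes\mathbb{Z}_{4}$). (2) There is no such group $G$ with $\mathcal{O}_{2}(G)=\frac{|G|}{2}-2$, and none with $\mathcal{O}_{2}(G)=\frac{|G|}{2}-3$. (3) $\mathcal{O}_{2}(G)=\frac{|G|}{2}-4$ if and only if $G\cong\mathbb{Z}_{10}$.
   Context: For a finite group $G$, $C(G)$ is the set of all cyclic subgroups of $G$ (including the trivial one), and $\mathcal{O}_2(G)$ is the number of elements of order $2$ in $G$. $\mathbb{Z}_n$ is the cyclic group of order $n$. SmallGroup$[i,j]$ is the $j$-th group of order $i$ in GAP's SmallGroups library; SmallGroup$[20,1]$ is the dicyclic group $\langle a,b\mid a^5=b^4=1,\ bab^{-1}=a^{-1}\rangle$. *)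

theory Defs
  imports "HOL-Algebra.Algebra"
begin

definition cyclic_subgroups :: "('a, 'b) monoid_scheme \<Rightarrow> 'a set set" where
  "cyclic_subgroups G = {H. subgroup H G \<and> cyclic_group (G\<lparr>carrier := H\<rparr>)}"

definition num_involutions :: "('a, 'b) monoid_scheme \<Rightarrow> nat" where
  "num_involutions G = card {x \<in> carrier G. group.ord G x = 2}"

definition semidirect_product ::
  "('a, 'c) monoid_scheme \<Rightarrow> ('b, 'd) monoid_scheme \<Rightarrow> ('b \<Rightarrow> 'a \<Rightarrow> 'a) \<Rightarrow> ('a \<times> 'b) monoid"
  where
  "semidirect_product N H \<phi> =
     \<lparr>carrier = carrier N \<times> carrier H,
      monoid.mult = (\<lambda>(n, h) (n', h'). (n \<otimes>\<^bsub>N\<^esub> \<phi> h n', h \<otimes>\<^bsub>H\<^esub> h')),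
      one = (\<one>\<^bsub>N\<^esub>, \<one>\<^bsub>H\<^esub>)\<rparr>"

text \<open>The dicyclic group of order 20, with presentation
  \<open>\<langle>a, b | a^5 = b^4 = 1, b a b^-1 = a^-1\<rangle>\<close>: the generator 1 of \<open>Z_4\<close> acts on \<open>Z_5\<close> by
  inversion (so the action is not faithful). Here \<open>a = (1, 0)\<close>, \<open>b = (0, 1)\<close>, and
  \<open>(i, j)\<close> stands for \<open>a^i b^j\<close>. That this group is the one presented is
  verified below by its relations, generation and universal property.\<close>

definition dicyclic_group_20 :: "(int \<times> int) monoid" where
  "dicyclic_group_20 =
     semidirect_product (integer_mod_group 5) (integer_mod_group 4)
       (\<lambda>j i. if even j then i else inv\<^bsub>integer_mod_group 5\<^esub> i)"

lemma carrier_dicyclic: "carrier dicyclic_group_20 = {0..<5} \<times> {0..<4}"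
  by (simp add: dicyclic_group_20_def semidirect_product_def carrier_integer_mod_group)

lemma one_dicyclic: "\<one>\<^bsub>dicyclic_group_20\<^esub> = (0, 0)"
  by (simp add: dicyclic_group_20_def semidirect_product_def)

lemma mult_dicyclic:
  assumes "i' \<in> {0..<5}"
  shows "(i, j) \<otimes>\<^bsub>dicyclic_group_20\<^esub> (i', j') =
    ((if even j then i + i' else i - i') mod 5, (j + j') mod 4)"
  using assms
  by (simp add: dicyclic_group_20_def semidirect_product_def carrier_integer_mod_group mod_simps)

lemma order_dicyclic: "order dicyclic_group_20 = 20"
  by (simp add: order_def carrier_dicyclic)

lemma group_dicyclic: "group dicyclic_group_20"
proof (rule groupI)
  fix x y
  assume "x \<in> carrier dicyclic_group_20" "y \<in> carrier dicyclic_group_20"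
  then show "x \<otimes>\<^bsub>dicyclic_group_20\<^esub> y \<in> carrier dicyclic_group_20"
    by (cases x; cases y) (auto simp: carrier_dicyclic mult_dicyclic)
next
  show "\<one>\<^bsub>dicyclic_group_20\<^esub> \<in> carrier dicyclic_group_20"
    by (simp add: carrier_dicyclic one_dicyclic)
next
  fix x y z
  assume "x \<in> carrier dicyclic_group_20" "y \<in> carrier dicyclic_group_20"
    "z \<in> carrier dicyclic_group_20"
  moreover have "even ((j + j') mod 4) \<longleftrightarrow> even (j + j')" for j j' :: int
    by presburger
  ultimately show "x \<otimes>\<^bsub>dicyclic_group_20\<^esub> y \<otimes>\<^bsub>dicyclic_group_20\<^esub> z =
      x \<otimes>\<^bsub>dicyclic_group_20\<^esub> (y \<otimes>\<^bsub>dicyclic_group_20\<^esub> z)"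
    by (cases x; cases y; cases z) (auto simp: carrier_dicyclic mult_dicyclic mod_simps algebra_simps)
next
  fix x
  assume "x \<in> carrier dicyclic_group_20"
  then show "\<one>\<^bsub>dicyclic_group_20\<^esub> \<otimes>\<^bsub>dicyclic_group_20\<^esub> x = x"
    by (cases x) (auto simp: carrier_dicyclic one_dicyclic mult_dicyclic)
next
  fix x
  assume x: "x \<in> carrier dicyclic_group_20"
  obtain i j where ij: "x = (i, j)" by (cases x)
  let ?y = "((if even j then - i else i) mod 5, (- j) mod 4)"
  have "even ((- j) mod 4) \<longleftrightarrow> even j"
    by presburger
  then have "?y \<otimes>\<^bsub>dicyclic_group_20\<^esub> x = \<one>\<^bsub>dicyclic_group_20\<^esub>"
    using x ij by (auto simp: carrier_dicyclic one_dicyclic mult_dicyclic mod_simps)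
  moreover have "?y \<in> carrier dicyclic_group_20"
    by (simp add: carrier_dicyclic)
  ultimately show "\<exists>y \<in> carrier dicyclic_group_20.
      y \<otimes>\<^bsub>dicyclic_group_20\<^esub> x = \<one>\<^bsub>dicyclic_group_20\<^esub>"
    by blast
qed

lemma dicyclic_pow_a:
  "(1, 0) [^]\<^bsub>dicyclic_group_20\<^esub> (n::nat) = (int n mod 5, 0)"
proof -
  interpret group dicyclic_group_20 by (rule group_dicyclic)
  show ?thesis
    by (induction n) (auto simp: one_dicyclic mult_dicyclic mod_simps algebra_simps)
qed

lemma dicyclic_pow_b:
  "(0, 1) [^]\<^bsub>dicyclic_group_20\<^esub> (n::nat) = (0, int n mod 4)"
proof -
  interpret group dicyclic_group_20 by (rule group_dicyclic)
  show ?thesis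
    by (induction n) (auto simp: one_dicyclic mult_dicyclic mod_simps algebra_simps)
qed

lemma dicyclic_relations:
  "(1, 0) [^]\<^bsub>dicyclic_group_20\<^esub> (5::nat) = \<one>\<^bsub>dicyclic_group_20\<^esub>"
  "(0, 1) [^]\<^bsub>dicyclic_group_20\<^esub> (4::nat) = \<one>\<^bsub>dicyclic_group_20\<^esub>"
  "(0, 1) \<otimes>\<^bsub>dicyclic_group_20\<^esub> (1, 0) \<otimes>\<^bsub>dicyclic_group_20\<^esub> inv\<^bsub>dicyclic_group_20\<^esub> (0, 1) =
     inv\<^bsub>dicyclic_group_20\<^esub> (1, 0)"
proof -
  interpret group dicyclic_group_20 by (rule group_dicyclic)
  have ia: "inv\<^bsub>dicyclic_group_20\<^esub> (1, 0) = (4, 0)"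
    by (rule inv_equality) (auto simp: carrier_dicyclic one_dicyclic mult_dicyclic)
  have ib: "inv\<^bsub>dicyclic_group_20\<^esub> (0, 1) = (0, 3)"
    by (rule inv_equality) (auto simp: carrier_dicyclic one_dicyclic mult_dicyclic)
  show "(1, 0) [^]\<^bsub>dicyclic_group_20\<^esub> (5::nat) = \<one>\<^bsub>dicyclic_group_20\<^esub>"
    and "(0, 1) [^]\<^bsub>dicyclic_group_20\<^esub> (4::nat) = \<one>\<^bsub>dicyclic_group_20\<^esub>"
    by (simp_all only: dicyclic_pow_a dicyclic_pow_b) (simp_all add: one_dicyclic)
  show "(0, 1) \<otimes>\<^bsub>dicyclic_group_20\<^esub> (1, 0) \<otimes>\<^bsub>dicyclic_group_20\<^esub> inv\<^bsub>dicyclic_group_20\<^esub> (0, 1) =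
     inv\<^bsub>dicyclic_group_20\<^esub> (1, 0)"
    by (simp add: ia ib mult_dicyclic)
qed

lemma dicyclic_generated:
  "generate dicyclic_group_20 {(1, 0), (0, 1)} = carrier dicyclic_group_20"
proof -
  interpret group dicyclic_group_20 by (rule group_dicyclic)
  let ?S = "generate dicyclic_group_20 {(1, 0), (0, 1)}"
  have sub: "subgroup ?S dicyclic_group_20"
    by (rule generate_is_subgroup) (simp add: carrier_dicyclic)
  have gens: "(1, 0) \<in> ?S" "(0, 1) \<in> ?S"
    by (auto intro: generate.incl)
  have pow: "x [^]\<^bsub>dicyclic_group_20\<^esub> n \<in> ?S" if "x \<in> ?S" for x and n :: nat
    using that by (induction n) (auto intro: generate.one generate.eng)
  have "x \<in> ?S" if x: "x \<in> carrier dicyclic_group_20" for x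
  proof -
    obtain i j where ij: "x = (i, j)" by (cases x)
    have "x = (1, 0) [^]\<^bsub>dicyclic_group_20\<^esub> nat i \<otimes>\<^bsub>dicyclic_group_20\<^esub>
              (0, 1) [^]\<^bsub>dicyclic_group_20\<^esub> nat j"
      using x by (auto simp: ij dicyclic_pow_a dicyclic_pow_b mult_dicyclic carrier_dicyclic)
    then show ?thesis
      using pow[OF gens(1)] pow[OF gens(2)] by (auto intro: generate.eng)
  qed
  then show ?thesis
    using subgroup.subset[OF sub] by blast
qed

lemma dicyclic_universal:
  assumes "group H" and x: "x \<in> carrier H" and y: "y \<in> carrier H"
    and x5: "x [^]\<^bsub>H\<^esub> (5::nat) = \<one>\<^bsub>H\<^esub>" and y4: "y [^]\<^bsub>H\<^esub> (4::nat) = \<one>\<^bsub>H\<^esub>"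
    and conj: "y \<otimes>\<^bsub>H\<^esub> x \<otimes>\<^bsub>H\<^esub> inv\<^bsub>H\<^esub> y = inv\<^bsub>H\<^esub> x"
  shows "\<exists>h \<in> hom dicyclic_group_20 H. h (1, 0) = x \<and> h (0, 1) = y"
proof -
  interpret H: group H by fact
  have xmod: "x [^]\<^bsub>H\<^esub> (k mod 5) = x [^]\<^bsub>H\<^esub> k" for k :: int
  proof -
    have "x [^]\<^bsub>H\<^esub> k = x [^]\<^bsub>H\<^esub> (5 * (k div 5) + k mod 5)" by simp
    also have "\<dots> = (x [^]\<^bsub>H\<^esub> (5::int)) [^]\<^bsub>H\<^esub> (k div 5) \<otimes>\<^bsub>H\<^esub> x [^]\<^bsub>H\<^esub> (k mod 5)"
      using x by (simp only: H.int_pow_mult H.int_pow_pow)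
    also have "x [^]\<^bsub>H\<^esub> (5::int) = \<one>\<^bsub>H\<^esub>"
      using x5 int_pow_int[of H x 5] by simp
    finally show ?thesis using x by simp
  qed
  have ymod: "y [^]\<^bsub>H\<^esub> (k mod 4) = y [^]\<^bsub>H\<^esub> k" for k :: int
  proof -
    have "y [^]\<^bsub>H\<^esub> k = y [^]\<^bsub>H\<^esub> (4 * (k div 4) + k mod 4)" by simp
    also have "\<dots> = (y [^]\<^bsub>H\<^esub> (4::int)) [^]\<^bsub>H\<^esub> (k div 4) \<otimes>\<^bsub>H\<^esub> y [^]\<^bsub>H\<^esub> (k mod 4)"
      using y by (simp only: H.int_pow_mult H.int_pow_pow)
    also have "y [^]\<^bsub>H\<^esub> (4::int) = \<one>\<^bsub>H\<^esub>"
      using y4 int_pow_int[of H y 4] by simp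
    finally show ?thesis using y by simp
  qed
  have yx: "y \<otimes>\<^bsub>H\<^esub> x = inv\<^bsub>H\<^esub> x \<otimes>\<^bsub>H\<^esub> y"
    using conj x y by (metis H.inv_closed H.m_closed H.inv_solve_right')
  have yxn: "y \<otimes>\<^bsub>H\<^esub> x [^]\<^bsub>H\<^esub> n = x [^]\<^bsub>H\<^esub> (- int n) \<otimes>\<^bsub>H\<^esub> y" for n :: nat
  proof (induction n)
    case 0
    show ?case using y by simp
  next
    case (Suc n)
    have "y \<otimes>\<^bsub>H\<^esub> x [^]\<^bsub>H\<^esub> Suc n = (y \<otimes>\<^bsub>H\<^esub> x [^]\<^bsub>H\<^esub> n) \<otimes>\<^bsub>H\<^esub> x"
      using x y by (simp add: H.m_assoc)
    also have "\<dots> = x [^]\<^bsub>H\<^esub> (- int n) \<otimes>\<^bsub>H\<^esub> (y \<otimes>\<^bsub>H\<^esub> x)"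
      using x y by (simp add: Suc.IH H.m_assoc)
    also have "\<dots> = (x [^]\<^bsub>H\<^esub> (- int n) \<otimes>\<^bsub>H\<^esub> x [^]\<^bsub>H\<^esub> (- 1 :: int)) \<otimes>\<^bsub>H\<^esub> y"
      using x y by (simp add: yx H.m_assoc H.int_pow_neg)
    also have "\<dots> = x [^]\<^bsub>H\<^esub> (- int (Suc n)) \<otimes>\<^bsub>H\<^esub> y"
      using x by (simp add: H.int_pow_mult[symmetric] algebra_simps)
    finally show ?case .
  qed
  have yj: "y [^]\<^bsub>H\<^esub> m \<otimes>\<^bsub>H\<^esub> x [^]\<^bsub>H\<^esub> i =
      x [^]\<^bsub>H\<^esub> (if even m then i else - i) \<otimes>\<^bsub>H\<^esub> y [^]\<^bsub>H\<^esub> m" for m :: nat and i :: int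
  proof (induction m)
    case 0
    show ?case using x by simp
  next
    case (Suc m)
    let ?i = "if even m then i else - i"
    note suc = H.nat_pow_Suc2[OF y, of m]
    have 1: "y \<otimes>\<^bsub>H\<^esub> x [^]\<^bsub>H\<^esub> k = x [^]\<^bsub>H\<^esub> (- k) \<otimes>\<^bsub>H\<^esub> y" for k :: int
    proof -
      have "y \<otimes>\<^bsub>H\<^esub> x [^]\<^bsub>H\<^esub> (k mod 5) = x [^]\<^bsub>H\<^esub> (- (k mod 5)) \<otimes>\<^bsub>H\<^esub> y"
        using yxn[of "nat (k mod 5)"] int_pow_int[of H x "nat (k mod 5)"] by simp
      then show ?thesis
        using xmod[of k] xmod[of "- k"] xmod[of "- (k mod 5)"] by (simp add: mod_minus_eq)
    qed
    have "y [^]\<^bsub>H\<^esub> Suc m \<otimes>\<^bsub>H\<^esub> x [^]\<^bsub>H\<^esub> i = y \<otimes>\<^bsub>H\<^esub> (y [^]\<^bsub>H\<^esub> m \<otimes>\<^bsub>H\<^esub> x [^]\<^bsub>H\<^esub> i)"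
      using x y by (simp only: suc) (simp add: H.m_assoc)
    also have "\<dots> = (y \<otimes>\<^bsub>H\<^esub> x [^]\<^bsub>H\<^esub> ?i) \<otimes>\<^bsub>H\<^esub> y [^]\<^bsub>H\<^esub> m"
      using x y by (simp only: Suc.IH) (simp add: H.m_assoc)
    also have "\<dots> = x [^]\<^bsub>H\<^esub> (- ?i) \<otimes>\<^bsub>H\<^esub> y [^]\<^bsub>H\<^esub> Suc m"
      using x y by (simp only: 1 suc) (simp add: H.m_assoc)
    finally show ?case by (simp only: even_Suc minus_minus split: if_split) simp
  qed
  define h where "h = (\<lambda>(i::int, j::int). x [^]\<^bsub>H\<^esub> i \<otimes>\<^bsub>H\<^esub> y [^]\<^bsub>H\<^esub> j)"
  have "h \<in> hom dicyclic_group_20 H"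
  proof (rule homI)
    fix u
    assume "u \<in> carrier dicyclic_group_20"
    show "h u \<in> carrier H"
      using x y by (cases u) (simp add: h_def)
  next
    fix u v
    assume u: "u \<in> carrier dicyclic_group_20" and v: "v \<in> carrier dicyclic_group_20"
    obtain i j where ij: "u = (i, j)" by (cases u)
    obtain i' j' where ij': "v = (i', j')" by (cases v)
    let ?s = "if even j then i' else - i'"
    have j0: "0 \<le> j" and i': "i' \<in> {0..<5}"
      using u v by (auto simp: ij ij' carrier_dicyclic)
    have sw: "y [^]\<^bsub>H\<^esub> j \<otimes>\<^bsub>H\<^esub> x [^]\<^bsub>H\<^esub> i' = x [^]\<^bsub>H\<^esub> ?s \<otimes>\<^bsub>H\<^esub> y [^]\<^bsub>H\<^esub> j"
      using yj[of "nat j" i'] int_pow_int[of H y "nat j"] j0 by (simp add: even_nat_iff)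
    have "h (u \<otimes>\<^bsub>dicyclic_group_20\<^esub> v) = x [^]\<^bsub>H\<^esub> (i + ?s) \<otimes>\<^bsub>H\<^esub> y [^]\<^bsub>H\<^esub> (j + j')"
      using i' by (simp add: h_def ij ij' mult_dicyclic xmod ymod)
    also have "\<dots> = x [^]\<^bsub>H\<^esub> i \<otimes>\<^bsub>H\<^esub> (x [^]\<^bsub>H\<^esub> ?s \<otimes>\<^bsub>H\<^esub> y [^]\<^bsub>H\<^esub> j) \<otimes>\<^bsub>H\<^esub> y [^]\<^bsub>H\<^esub> j'"
      using x y by (simp add: H.int_pow_mult H.m_assoc)
    also have "\<dots> = h u \<otimes>\<^bsub>H\<^esub> h v"
      using x y by (simp add: sw[symmetric] h_def ij ij' H.m_assoc)
    finally show "h (u \<otimes>\<^bsub>dicyclic_group_20\<^esub> v) = h u \<otimes>\<^bsub>H\<^esub> h v" .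
  qed
  moreover have "h (1, 0) = x" "h (0, 1) = y"
    using x y by (simp_all add: h_def)
  ultimately show ?thesis by blast
qed

end

theory Submission
  imports Defs "HOL-Number_Theory.Totient"
begin

text \<open>
  Count the elements of \<open>G\<close> by the cyclic subgroup they generate and write \<open>t\<close> for the number of
  involutions. The hypothesis becomes: the sum of \<open>\<phi>(|C|) - 2\<close> over the cyclic subgroups \<open>C\<close> with
  \<open>|C| > 2\<close> equals \<open>t + 3\<close>, while the number of these \<open>C\<close> is \<open>|G|/2 - 2 - t\<close>.

  If \<open>t = 1\<close>, the involution \<open>z\<close> is central, multiplication by \<open>z\<close> doubles odd orders, and the sum is
  4. Hence exactly two cyclic subgroups have \<open>\<phi> = 4\<close>, and the others have order 1, 2, 3, 4 or 6.
  Were these two of order 8 or 12, their generators \<open>x\<close>, \<open>y\<close> would normalize each other's subgroups;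
  as \<open>k\<^sup>2 = 1\<close> modulo 8 and 12 for every unit \<open>k\<close>, the square of each would commute with the other,
  and since commuting elements with equal squares differ at most by the factor \<open>z\<close>, either one of the
  two subgroups would contain the other or a cyclic subgroup of order 12 or 24 too many would
  appear. So there is \<open>a\<close> of order 5, the centralizer of \<open>a\<close> is
  the cyclic group of order 10 generated by \<open>a z\<close>, and every element outside has order 4 and inverts
  \<open>a\<close>. Therefore \<open>|G|\<close> is 10 or 20.

  The values of \<open>t\<close> in (2) and (3) mean that there are 0, 1 or 2 cyclic subgroups of order above 2.
  In the first case the sum is empty, and the second contradicts \<open>2 \<phi>(m) \<le> m\<close> for even \<open>m\<close>. In the last one, \<open>|G| = 2 k\<close> with \<open>k\<close> odd,
  and the two totients add up to \<open>k + 3\<close>, too much unless one of the subgroups has index at most 2;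
  this forces \<open>G\<close> to be cyclic.
\<close>

section \<open>Totients\<close>

lemma totient_3: "totient 3 = 2" and totient_5: "totient 5 = 4" and totient_7: "totient 7 = 6"
  by (simp_all add: totient_prime)

lemma totient_8: "totient 8 = 4" and totient_9: "totient 9 = 6"
  using totient_prime_power[of 2 3] totient_prime_power[of 3 2] by simp_all

lemma totient_10: "totient 10 = 4"
  using totient_double[of 5] totient_5 by simp

lemma totient_12: "totient 12 = 4" and totient_15: "totient 15 = 8"
  and totient_20: "totient 20 = 8" and totient_24: "totient 24 = 8"
proof -
  have "coprime 4 (3::nat)" "coprime 3 (5::nat)" "coprime 4 (5::nat)" "coprime 8 (3::nat)"
    by code_simp+
  then show "totient 12 = 4" "totient 15 = 8" "totient 20 = 8" "totient 24 = 8"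
    using totient_mult_coprime[of 4 3] totient_mult_coprime[of 3 5] totient_mult_coprime[of 4 5]
      totient_mult_coprime[of 8 3] totient_3 totient_5 totient_8 by simp_all
qed

text \<open>A prime power dividing \<open>m\<close> has totient at most 6 as well, which leaves the
  prime powers 2, 4, 8, 3 and 5 once 7 and 9 are excluded. So \<open>m\<close> divides 120, and the
  divisors 15, 20 and 24 are impossible because their totient is 8.\<close>

lemma totient_le_6_cases:
  assumes m: "m > 0" "totient m \<le> 6" "\<not> 7 dvd m" "\<not> 9 dvd m"
  shows "m \<in> {1,2,3,4,5,6,8,10,12}"
proof -
  have "m dvd 120"
  proof (rule multiplicity_le_imp_dvd)
    fix p :: nat assume p: "Factorial_Ring.prime p"
    define k where "k = multiplicity p m"
    have "p ^ k dvd 120"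
    proof (cases k)
      case (Suc j)
      have pk: "p ^ k dvd m" unfolding k_def by (rule multiplicity_dvd)
      have "totient (p ^ k) \<le> totient m" by (rule totient_dvd_mono[OF pk m(1)])
      then have le: "p ^ j * (p - 1) \<le> 6" using totient_prime_power_Suc[OF p] m(2) Suc by simp
      have "1 \<le> p ^ j" using prime_gt_0_nat[OF p] by simp
      then have "p - 1 \<le> 6" using le mult_le_mono1[of 1 "p ^ j" "p - 1"] by linarith
      then have "p \<le> 7" by linarith
      moreover have "p dvd m" using pk Suc by (metis dvd_power_le dvd_refl dvd_trans le_add1 plus_1_eq_Suc power_one_right)
      ultimately have "p \<noteq> 7" "p \<le> 7" using m(3) by auto
      moreover have "p \<noteq> 0" "p \<noteq> 1" "p \<noteq> 4" "p \<noteq> 6"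
        using p by (auto simp: prime_nat_iff dest!: spec[of _ 2])
      ultimately consider "p = 2" | "p = 3" | "p = 5" by linarith
      then show ?thesis
      proof cases
        case 1
        have "j < 3"
        proof (rule ccontr)
          assume "\<not> j < 3"
          then have "(2::nat) ^ 3 \<le> 2 ^ j" by (intro power_increasing) auto
          then show False using le 1 by simp
        qed
        then have "(2::nat) ^ k dvd 2 ^ 3" using Suc by (intro le_imp_power_dvd) simp
        also have "(2::nat) ^ 3 dvd 120" by simp
        finally show ?thesis using 1 by simp
      next
        case 2
        have "j = 0"
        proof (rule ccontr)
          assume "j \<noteq> 0"
          then have "(3::nat) ^ 2 dvd 3 ^ k" using Suc by (intro le_imp_power_dvd) simp
          then show False using pk 2 m(4) dvd_trans[of 9 "3 ^ k" m] by simp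
        qed
        then show ?thesis using 2 Suc by simp
      next
        case 3
        have "j = 0"
        proof (rule ccontr)
          assume "j \<noteq> 0"
          then have "(5::nat) ^ 1 \<le> 5 ^ j" by (intro power_increasing) auto
          then show False using le 3 by simp
        qed
        then show ?thesis using 3 Suc by simp
      qed
    qed simp
    then show "multiplicity p m \<le> multiplicity p 120"
      using p unfolding k_def by (intro multiplicity_geI) (auto simp: prime_gt_1_nat)
  qed (use m in simp)
  then have "m dvd 8 * (3 * 5)" by simp
  then obtain b e where be: "m = b * e" "b dvd 8" "e dvd 3 * 5" using division_decomp by blast
  obtain c d where cd: "e = c * d" "c dvd 3" "d dvd 5" using division_decomp[OF be(3)] by blast
  have "b dvd 2 ^ 3" using be(2) by simp
  then obtain i where "i \<le> 3" "b = 2 ^ i" using divides_primepow_nat[OF two_is_prime_nat] by blast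
  then have "b \<in> {1,2,4,8}" by (auto simp: le_Suc_eq numeral_3_eq_3)
  moreover have "c \<in> {1,3}" "d \<in> {1,5}"
    using cd(2,3) prime_nat_iff[of 3] prime_nat_iff[of 5] by auto
  moreover have "\<not> 15 dvd m" "\<not> 20 dvd m" "\<not> 24 dvd m"
    using totient_dvd_mono[of _ m] m totient_15 totient_20 totient_24 by fastforce+
  ultimately show ?thesis using be(1) cd(1) by auto
qed

text \<open>The unit groups modulo 8 and 12 have exponent 2, so every automorphism of a cyclic group
  of order 8 or 12 squares to the identity. A finite evaluation confirms the arithmetic.\<close>

lemma square_mod_8_12:
  assumes "m \<in> {8, 12::nat}" "coprime k m"
  shows "k ^ 2 mod m = 1"
proof -
  have "\<forall>m\<in>{8, 12}. \<forall>r\<in>set [0..<m]. coprime r m \<longrightarrow> r ^ 2 mod m = 1" by code_simp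
  moreover have "k mod m \<in> set [0..<m]" "coprime (k mod m) m" using assms by auto
  ultimately have "(k mod m) ^ 2 mod m = 1" using assms(1) by blast
  then show ?thesis by (simp add: power_mod)
qed

text \<open>Doubling an even number doubles its totient, which reduces the claim to half of
  \<open>n\<close>; doubling an odd number leaves the totient unchanged.\<close>

lemma totient_even_le_half:
  fixes n :: nat
  shows "even n \<Longrightarrow> 2 * totient n \<le> n"
proof (induction n rule: less_induct)
  case (less n)
  then obtain k where k: "n = 2 * k" by blast
  show ?case
  proof (cases "even k")
    case True
    show ?thesis
    proof (cases "k = 0")
      case False
      then have "2 * totient k \<le> k" using less.IH[of k] k True by simp
      then show ?thesis using True by (simp add: k totient_double)
    qed (simp add: k)
  next
    case False
    then show ?thesis using totient_le[of k] by (simp add: k totient_double)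
  qed
qed

text \<open>As \<open>k\<close> is odd, a proper divisor of \<open>k\<close> has cofactor at least
  3. This applies to \<open>m\<close> itself if \<open>m\<close> is odd, and to
  \<open>m / 2\<close>, which already bounds the totient, if \<open>m\<close> is even.\<close>

lemma totient_le_third:
  fixes k m :: nat
  assumes k: "odd k" and m: "m dvd 2 * k" "m \<noteq> 2 * k" "m \<noteq> k"
  shows "3 * totient m \<le> k"
proof (cases "even m")
  case True
  then obtain l where l: "m = 2 * l" by blast
  have "l dvd k" "l \<noteq> k" using m(1,2) l by auto
  then obtain q where q: "k = l * q" "q \<noteq> 1" by auto
  have "odd q" using k q(1) by simp
  then have "q \<ge> 3" using q(2) by presburger
  then have "l * 3 \<le> k" unfolding q(1) by (rule mult_le_mono2)
  moreover have "2 * totient m \<le> m" using totient_even_le_half[OF True] .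
  ultimately show ?thesis using l by linarith
next
  case False
  then have "coprime m 2" by simp
  then have "m dvd k" using m(1) coprime_dvd_mult_right_iff by blast
  then obtain q where q: "k = m * q" "q \<noteq> 1" using m(3) by auto
  have "odd q" using k q(1) by simp
  then have "q \<ge> 3" using q(2) by presburger
  then have "m * 3 \<le> k" unfolding q(1) by (rule mult_le_mono2)
  then show ?thesis using totient_le[of m] by linarith
qed

section \<open>Cyclic subgroups of a finite group\<close>

locale finite_group = group G for G (structure) +
  assumes finite_carrier: "finite (carrier G)"
begin

section \<open>The subgroup generated by one element\<close>

abbreviation cyc :: "'a \<Rightarrow> 'a set" where "cyc x \<equiv> generate G {x}"

lemma ord_pos: "x \<in> carrier G \<Longrightarrow> ord x > 0"
  using ord_ge_1[OF finite_carrier] by fastforce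

lemma mem_cyc_iff: "x \<in> carrier G \<Longrightarrow> y \<in> cyc x \<longleftrightarrow> (\<exists>k::nat. y = x [^] k)"
  using generate_pow_on_finite_carrier[OF finite_carrier] by auto

lemma subgroup_cyc: "x \<in> carrier G \<Longrightarrow> subgroup (cyc x) G"
  by (rule generate_is_subgroup) simp

lemma cyc_in_carrier: "x \<in> carrier G \<Longrightarrow> y \<in> cyc x \<Longrightarrow> y \<in> carrier G"
  using subgroup.mem_carrier[OF subgroup_cyc] by blast

lemma cyc_self: "x \<in> cyc x"
  by (rule generate.incl) simp

lemma cyc_mult: "y \<in> cyc x \<Longrightarrow> z \<in> cyc x \<Longrightarrow> y \<otimes> z \<in> cyc x"
  by (rule generate.eng)

lemma cyc_inv: "x \<in> carrier G \<Longrightarrow> y \<in> cyc x \<Longrightarrow> inv y \<in> cyc x"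
  using subgroup.m_inv_closed[OF subgroup_cyc] by blast

lemma cyc_pow: "x \<in> carrier G \<Longrightarrow> y \<in> cyc x \<Longrightarrow> y [^] (k::nat) \<in> cyc x"
  by (induction k) (auto intro: generate.one generate.eng)

lemma cyc_mono: "x \<in> carrier G \<Longrightarrow> y \<in> cyc x \<Longrightarrow> cyc y \<subseteq> cyc x"
  using generate_subgroup_incl[OF _ subgroup_cyc] by auto

lemma finite_cyc: "x \<in> carrier G \<Longrightarrow> finite (cyc x)"
  using finite_subset[OF _ finite_carrier] cyc_in_carrier by blast

lemma cyc_mult_left: "x \<in> carrier G \<Longrightarrow> y \<in> cyc x \<Longrightarrow> w \<in> carrier G \<Longrightarrow> y \<otimes> w \<in> cyc x \<longleftrightarrow> w \<in> cyc x"
  by (metis cyc_in_carrier cyc_inv cyc_mult inv_solve_left)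

lemma cyc_mult_right: "x \<in> carrier G \<Longrightarrow> y \<in> cyc x \<Longrightarrow> w \<in> carrier G \<Longrightarrow> w \<otimes> y \<in> cyc x \<longleftrightarrow> w \<in> cyc x"
  by (metis cyc_in_carrier cyc_inv cyc_mult inv_solve_right)

lemma cyc_eq:
  assumes "x \<in> carrier G" "y \<in> cyc x" "ord y = ord x"
  shows "cyc y = cyc x"
  using assms cyc_mono[of x y] finite_cyc[of x] cyc_in_carrier[of x y]
  by (intro card_subset_eq) (simp_all flip: generate_pow_card)

text \<open>\<open>cyclic_group\<close> views the subgroup as a group in its own right; integer
  powers taken there agree with those of \<open>G\<close>, which turns its generator into a
  generator in the sense of \<open>cyc\<close>.\<close>

lemma cyclic_subgroups_eq: "cyclic_subgroups G = cyc ` carrier G"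
proof (intro equalityI subsetI)
  fix H assume "H \<in> cyclic_subgroups G"
  then have H: "subgroup H G" "cyclic_group (G\<lparr>carrier := H\<rparr>)"
    by (auto simp: cyclic_subgroups_def)
  interpret K: group "G\<lparr>carrier := H\<rparr>" by (rule subgroup_imp_group[OF H(1)])
  obtain x where x: "x \<in> carrier (G\<lparr>carrier := H\<rparr>)"
      "carrier (G\<lparr>carrier := H\<rparr>) = range (\<lambda>n::int. x [^]\<^bsub>G\<lparr>carrier := H\<rparr>\<^esub> n)"
    using iffD1[OF K.cyclic_group H(2)] by blast
  have xH: "x \<in> H" using x(1) by simp
  have xc: "x \<in> carrier G" by (rule subgroup.mem_carrier[OF H(1) xH])
  have "H = carrier (G\<lparr>carrier := H\<rparr>)" by simp
  also note x(2)
  also have "range (\<lambda>n::int. x [^]\<^bsub>G\<lparr>carrier := H\<rparr>\<^esub> n) = range (\<lambda>n::int. x [^] n)"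
    by (rule image_cong[OF refl]) (rule int_pow_consistent[OF H(1) xH, symmetric])
  finally have "H = range (\<lambda>n::int. x [^] n)" .
  then have "H = cyc x" unfolding generate_pow[OF xc] by blast
  then show "H \<in> cyc ` carrier G" using xc by blast
next
  fix H assume "H \<in> cyc ` carrier G"
  then obtain x where x: "x \<in> carrier G" "H = cyc x" by blast
  have "carrier (subgroup_generated G {x}) = H" using x by (simp add: carrier_subgroup_generated)
  then have "subgroup_generated G {x} = G\<lparr>carrier := H\<rparr>"
    by (simp add: subgroup_generated_def)
  then show "H \<in> cyclic_subgroups G"
    using x subgroup_cyc cyclic_group_generated[of x] by (simp add: cyclic_subgroups_def)
qed

text \<open>A power of \<open>x\<close> generates \<open>cyc x\<close> exactly when its exponent is
  coprime to \<open>ord x\<close>, so the generators correspond to the totatives.\<close>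

lemma card_generators:
  assumes x: "x \<in> carrier G"
  shows "card {y \<in> carrier G. cyc y = cyc x} = totient (ord x)"
proof -
  have "{y \<in> carrier G. cyc y = cyc x} = (\<lambda>k. x [^] k) ` totatives (ord x)"
  proof (intro equalityI subsetI)
    fix y assume y: "y \<in> {y \<in> carrier G. cyc y = cyc x}"
    then have "y \<in> cyc x" using cyc_self[of y] by simp
    then obtain k where k: "y = x [^] k" "k \<le> ord x - 1"
      unfolding generate_pow_on_finite_carrier[OF finite_carrier x] ord_elems[OF finite_carrier x]
      by auto
    have oy: "ord y = ord x" using y x generate_pow_card by auto
    show "y \<in> (\<lambda>k. x [^] k) ` totatives (ord x)"
    \<comment> \<open>The totatives are positive; the exponent 0, which occurs only for trivial
      \<open>x\<close>, is replaced by 1.\<close>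
    proof (cases "k = 0")
      case True
      then have "ord x = 1" using oy k by simp
      then have "1 \<in> totatives (ord x)" "y = x [^] (1::nat)" using k True x ord_eq_1 by auto
      then show ?thesis by blast
    next
      case False
      have "coprime k (ord x)" using pow_ord_eq_ord_iff[OF finite_carrier x] oy k by simp
      then show ?thesis using False k by (auto simp: in_totatives_iff)
    qed
  next
    fix y assume "y \<in> (\<lambda>k. x [^] k) ` totatives (ord x)"
    then obtain k where k: "y = x [^] k" "coprime k (ord x)" by (auto simp: in_totatives_iff)
    then have "ord y = ord x" using pow_ord_eq_ord_iff[OF finite_carrier x] by simp
    moreover have "y \<in> cyc x" unfolding mem_cyc_iff[OF x] k(1) by (rule exI, rule refl)
    ultimately show "y \<in> {y \<in> carrier G. cyc y = cyc x}"
      using cyc_eq[OF x] cyc_in_carrier[OF x] by simp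
  qed
  moreover have "inj_on (\<lambda>k. x [^] k) (totatives (ord x))"
    by (rule inj_on_subset[OF ord_inj'[OF x]]) (auto simp: in_totatives_iff)
  ultimately show ?thesis by (simp add: card_image totient_def)
qed

section \<open>Counting elements and cyclic subgroups\<close>

lemma finite_cyclic_subgroups: "finite (cyclic_subgroups G)"
  by (simp add: cyclic_subgroups_eq finite_carrier)

text \<open>The elements are partitioned by the cyclic subgroup they generate, and \<open>P\<close>
  sees only the order of that subgroup.\<close>

lemma card_elements_by_order:
  "card {x \<in> carrier G. P (ord x)} = (\<Sum>C | C \<in> cyclic_subgroups G \<and> P (card C). totient (card C))"
proof -
  let ?S = "{C \<in> cyclic_subgroups G. P (card C)}"
  let ?gen = "\<lambda>C. {y \<in> carrier G. cyc y = C}"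
  have "{x \<in> carrier G. P (ord x)} = (\<Union>C\<in>?S. ?gen C)"
    by (auto simp: cyclic_subgroups_eq generate_pow_card)
  also have "card \<dots> = (\<Sum>C\<in>?S. card (?gen C))"
    by (rule card_UN_disjoint) (auto simp: finite_cyclic_subgroups finite_carrier)
  also have "\<dots> = (\<Sum>C\<in>?S. totient (card C))"
    by (rule sum.cong) (auto simp: cyclic_subgroups_eq card_generators generate_pow_card)
  finally show ?thesis .
qed

text \<open>Subgroups of order 1 or 2 have a single generator; only the remaining ones make the
  number of elements exceed the number of cyclic subgroups.\<close>

definition big_cyclic_subgroups :: "'a set set" where
  "big_cyclic_subgroups = {C \<in> cyclic_subgroups G. card C > 2}"

lemma finite_big: "finite big_cyclic_subgroups"
  by (simp add: big_cyclic_subgroups_def finite_cyclic_subgroups)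

lemma num_involutions_eq_card: "num_involutions G = card {C \<in> cyclic_subgroups G. card C = 2}"
  using card_elements_by_order[of "\<lambda>m. m = 2"] by (simp add: num_involutions_def)

lemma card_cyclic_subgroups_pos: "C \<in> cyclic_subgroups G \<Longrightarrow> card C > 0"
  by (auto simp: cyclic_subgroups_eq ord_pos simp flip: generate_pow_card)

lemma card_trivial: "card {C \<in> cyclic_subgroups G. card C = 1} = 1"
proof -
  have "{x \<in> carrier G. ord x = 1} = {\<one>}" using ord_eq_1 by auto
  then show ?thesis using card_elements_by_order[of "\<lambda>m. m = 1"] by simp
qed

text \<open>Stated for arbitrary \<open>f\<close> because two instances are needed: the constant 1
  counts the subgroups, and the totient counts the elements of \<open>G\<close>.\<close>

lemma sum_cyclic_subgroups:
  fixes f :: "nat \<Rightarrow> nat"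
  shows "(\<Sum>C\<in>cyclic_subgroups G. f (card C)) =
     f 1 + num_involutions G * f 2 + (\<Sum>C\<in>big_cyclic_subgroups. f (card C))"
proof -
  let ?CS = "cyclic_subgroups G"
  have "(\<Sum>C\<in>?CS. f (card C)) = (\<Sum>C\<in>?CS. (if card C = 1 then f 1 else 0)
      + (if card C = 2 then f 2 else 0) + (if card C > 2 then f (card C) else 0))"
  proof (rule sum.cong[OF refl])
    fix C assume "C \<in> ?CS"
    then have "card C = 1 \<or> card C = 2 \<or> card C > 2" using card_cyclic_subgroups_pos by fastforce
    then show "f (card C) = (if card C = 1 then f 1 else 0)
        + (if card C = 2 then f 2 else 0) + (if card C > 2 then f (card C) else 0)"
      by fastforce
  qed
  also have "\<dots> = (\<Sum>C | C \<in> ?CS \<and> card C = 1. f 1) + (\<Sum>C | C \<in> ?CS \<and> card C = 2. f 2)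
      + (\<Sum>C | C \<in> ?CS \<and> card C > 2. f (card C))"
    by (simp only: sum.distrib sum.inter_filter[OF finite_cyclic_subgroups])
  also have "(\<Sum>C | C \<in> ?CS \<and> card C = 1. f 1) = f 1"
    by (simp only: sum_constant card_trivial) simp
  also have "(\<Sum>C | C \<in> ?CS \<and> card C = 2. f 2) = num_involutions G * f 2"
    by (simp only: sum_constant num_involutions_eq_card) simp
  finally show ?thesis unfolding big_cyclic_subgroups_def .
qed

lemma card_cyclic_subgroups:
  "card (cyclic_subgroups G) = 1 + num_involutions G + card big_cyclic_subgroups"
  using sum_cyclic_subgroups[of "\<lambda>_. 1"] by simp

lemma order_eq_sum_totient:
  "order G = 1 + num_involutions G + (\<Sum>C\<in>big_cyclic_subgroups. totient (card C))"
  using card_elements_by_order[of "\<lambda>_. True"] sum_cyclic_subgroups[of totient]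
  by (simp add: order_def)

lemma big_iff: "C \<in> big_cyclic_subgroups \<longleftrightarrow> (\<exists>x\<in>carrier G. C = cyc x \<and> ord x > 2)"
  by (auto simp: big_cyclic_subgroups_def cyclic_subgroups_eq generate_pow_card)

lemma card_cyc: "x \<in> carrier G \<Longrightarrow> card (cyc x) = ord x"
  by (simp add: generate_pow_card)

lemma cyc_big: "x \<in> carrier G \<Longrightarrow> ord x > 2 \<Longrightarrow> cyc x \<in> big_cyclic_subgroups"
  using big_iff by blast

lemma even_sum_totient_big: "even (\<Sum>C\<in>big_cyclic_subgroups. totient (card C))"
  by (rule dvd_sum) (simp add: totient_even big_cyclic_subgroups_def)

lemma ord_mult_coprime:
  assumes x: "x \<in> carrier G" and y: "y \<in> carrier G" and xy: "x \<otimes> y = y \<otimes> x"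
    and cop: "coprime (ord x) (ord y)"
  shows "ord (x \<otimes> y) = ord x * ord y"
proof (rule dvd_antisym)
  show "ord (x \<otimes> y) dvd ord x * ord y" by (rule ord_mul_divides[OF xy x y])
  have *: "ord x dvd ord (x \<otimes> y)"
    if "x \<in> carrier G" "y \<in> carrier G" "x \<otimes> y = y \<otimes> x" "coprime (ord x) (ord y)" for x y
  proof -
    \<comment> \<open>This exponent kills both the product and \<open>y\<close>, hence also
      \<open>x\<close>; coprimality then removes the factor \<open>ord y\<close>.\<close>
    let ?n = "ord (x \<otimes> y) * ord y"
    have "x [^] ?n \<otimes> y [^] ?n = (x \<otimes> y) [^] ?n" using that pow_mult_distrib by simp
    also have "\<dots> = \<one>" using that by (simp add: pow_eq_id)
    also have "y [^] ?n = \<one>" using that by (simp add: pow_eq_id)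
    finally have "x [^] ?n = \<one>" using that by simp
    then have "ord x dvd ?n" using that by (simp add: pow_eq_id)
    then show ?thesis using that(4) coprime_dvd_mult_left_iff by blast
  qed
  show "ord x * ord y dvd ord (x \<otimes> y)"
    using *[OF x y xy cop] *[OF y x] xy cop by (metis coprime_commute divides_mult)
qed

section \<open>Conjugation acting on cyclic subgroups\<close>

lemma conj_pow:
  "g \<in> carrier G \<Longrightarrow> x \<in> carrier G \<Longrightarrow> g \<otimes> x [^] (n::nat) \<otimes> inv g = (g \<otimes> x \<otimes> inv g) [^] n"
proof (induction n)
  case (Suc n)
  have "g \<otimes> x [^] Suc n \<otimes> inv g = (g \<otimes> x [^] n \<otimes> inv g) \<otimes> (g \<otimes> x \<otimes> inv g)"
    using Suc.prems by (simp add: m_assoc inv_solve_left)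
  then show ?case using Suc by simp
qed simp

lemma ord_conj: "g \<in> carrier G \<Longrightarrow> x \<in> carrier G \<Longrightarrow> ord (g \<otimes> x \<otimes> inv g) = ord x"
  by (subst ord_unique) (auto simp: conj_pow[symmetric] pow_eq_id[symmetric] inv_solve_right')

lemma conj_eq_self_iff:
  "g \<in> carrier G \<Longrightarrow> x \<in> carrier G \<Longrightarrow> g \<otimes> x \<otimes> inv g = x \<longleftrightarrow> g \<otimes> x = x \<otimes> g"
  by (metis inv_closed inv_solve_right m_closed)

lemma pow_mod_ord: "x \<in> carrier G \<Longrightarrow> x [^] (k mod ord x) = x [^] k"
  by (metis mult_div_mod_eq nat_pow_closed nat_pow_mult nat_pow_one nat_pow_pow pow_ord_eq_1 l_one)

text \<open>Conjugation by \<open>g\<close> acts on \<open>cyc x\<close> as the \<open>k\<close>-th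
  power map, and iterating that map multiplies exponents.\<close>

lemma conj_iterate:
  assumes g: "g \<in> carrier G" and x: "x \<in> carrier G" and k: "g \<otimes> x \<otimes> inv g = x [^] (k::nat)"
  shows "g [^] (j::nat) \<otimes> x \<otimes> inv (g [^] j) = x [^] (k ^ j)"
proof (induction j)
  case (Suc j)
  have "g [^] Suc j \<otimes> x \<otimes> inv (g [^] Suc j) = g \<otimes> (g [^] j \<otimes> x \<otimes> inv (g [^] j)) \<otimes> inv g"
    using g x unfolding nat_pow_Suc2[OF g] by (simp add: inv_mult_group m_assoc)
  also have "\<dots> = (g \<otimes> x \<otimes> inv g) [^] (k ^ j)" using Suc g x by (simp add: conj_pow)
  also have "\<dots> = x [^] (k ^ Suc j)" using k x by (simp add: nat_pow_pow)
  finally show ?case .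
qed (use x in simp)

lemma totient_big_ge_2: "C \<in> big_cyclic_subgroups \<Longrightarrow> totient (card C) \<ge> 2"
  using totient_gt_1[of "card C"] by (simp add: big_cyclic_subgroups_def)

lemma pow_commute:
  "x \<in> carrier G \<Longrightarrow> y \<in> carrier G \<Longrightarrow> x \<otimes> y = y \<otimes> x \<Longrightarrow> x [^] (m::nat) \<otimes> y [^] (n::nat) = y [^] n \<otimes> x [^] m"
  using group_commutes_pow[of y "x [^] m" n] group_commutes_pow[of x y m] by simp

lemma ord_dvd_of_mem_cyc:
  assumes x: "x \<in> carrier G" and y: "y \<in> cyc x"
  shows "ord y dvd ord x"
proof -
  obtain k :: nat where k: "y = x [^] k" using y mem_cyc_iff[OF x] by blast
  have "y [^] ord x = x [^] (k * ord x)" unfolding k by (rule nat_pow_pow[OF x])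
  also have "\<dots> = \<one>" using pow_eq_id[OF x] by simp
  finally show ?thesis using pow_eq_id[of y "ord x"] x k by simp
qed

lemma cyc_conj_mem:
  assumes "x \<in> carrier G" "y \<in> carrier G" "x \<otimes> y \<otimes> inv x \<in> cyc x"
  shows "y \<in> cyc x"
proof -
  have "inv x \<otimes> ((x \<otimes> y \<otimes> inv x) \<otimes> x) \<in> cyc x"
    by (intro cyc_mult cyc_inv cyc_self assms)
  moreover have "inv x \<otimes> ((x \<otimes> y \<otimes> inv x) \<otimes> x) = y"
    using assms(1,2) by (simp add: m_assoc inv_solve_left')
  ultimately show ?thesis by simp
qed

text \<open>Conjugation by \<open>x\<close> raises \<open>y\<close> to some power \<open>k\<close>
  coprime to \<open>ord y\<close>; conjugating twice raises it to \<open>k ^ 2\<close>, which is 1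
  modulo 8 and modulo 12.\<close>

lemma conj_square_commutes:
  assumes x: "x \<in> carrier G" and y: "y \<in> carrier G" and o: "ord y \<in> {8, 12}"
    and c: "x \<otimes> y \<otimes> inv x \<in> cyc y"
  shows "x [^] (2::nat) \<otimes> y = y \<otimes> x [^] (2::nat)"
proof -
  obtain k :: nat where k: "x \<otimes> y \<otimes> inv x = y [^] k" using c mem_cyc_iff[OF y] by blast
  have "ord (y [^] k) = ord y" using ord_conj[OF x y] k by simp
  then have "coprime k (ord y)" using pow_ord_eq_ord_iff[OF finite_carrier y] by simp
  then have "k ^ 2 mod ord y = 1" using square_mod_8_12[OF o] by simp
  then have "y [^] (k ^ 2) = y" using pow_mod_ord[OF y, of "k ^ 2"] y by simp
  then have "x [^] (2::nat) \<otimes> y \<otimes> inv (x [^] (2::nat)) = y"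
    using conj_iterate[OF x y k, of 2] by simp
  then show ?thesis using conj_eq_self_iff x y by simp
qed

section \<open>Recognizing the groups of the classification\<close>

lemma cyclic_imp_iso_integer_mod_group:
  assumes c: "c \<in> carrier G" and gen: "carrier G = cyc c"
  shows "G \<cong> integer_mod_group (order G)"
proof -
  let ?n = "ord c"
  let ?h = "\<lambda>i::int. c [^] i"
  have n: "?n > 0" by (rule ord_pos[OF c])
  have on: "order G = ?n" using gen card_cyc[OF c] by (simp add: order_def)
  have carr: "carrier (integer_mod_group ?n) = {0..<int ?n}"
    using n by (simp add: carrier_integer_mod_group)
  have hom: "?h \<in> hom (integer_mod_group ?n) G"
  proof (rule homI)
    fix i j :: int
    have "c [^] ((i + j) mod int ?n) = c [^] (i + j)"
      unfolding int_pow_eq[OF c] by (simp add: minus_mod_eq_mult_div)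
    then show "?h (i \<otimes>\<^bsub>integer_mod_group ?n\<^esub> j) = ?h i \<otimes> ?h j"
      using int_pow_mult[OF c] by simp
  qed (use c in simp)
  have inj: "inj_on ?h {0..<int ?n}"
  proof (rule inj_onI)
    fix i j assume ij: "i \<in> {0..<int ?n}" "j \<in> {0..<int ?n}" "?h i = ?h j"
    then have "int ?n dvd j - i" unfolding int_pow_eq[OF c] by blast
    then have "j mod int ?n = i mod int ?n" by (simp only: mod_eq_dvd_iff)
    then show "i = j" using ij by simp
  qed
  have "?h ` {0..<int ?n} \<subseteq> carrier G" using c by auto
  moreover have "card (?h ` {0..<int ?n}) = card (carrier G)"
    using card_image[OF inj] on by (simp add: order_def)
  ultimately have "?h ` {0..<int ?n} = carrier G" using card_subset_eq[OF finite_carrier] by blast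
  then have "?h \<in> iso (integer_mod_group ?n) G"
    using hom inj carr by (simp add: iso_def bij_betw_def)
  then have "integer_mod_group ?n \<cong> G" by (rule is_isoI)
  then show ?thesis unfolding on by (rule group.iso_sym[OF group_integer_mod_group])
qed

text \<open>The relations yield a homomorphism from the dicyclic group. Its image is a subgroup
  containing \<open>a\<close> and \<open>b\<close>, so it is onto by \<open>gen\<close>, and
  equality of orders makes it injective.\<close>

lemma iso_dicyclic_group_20:
  assumes a: "a \<in> carrier G" and b: "b \<in> carrier G"
    and a5: "ord a = 5" and b4: "ord b = 4"
    and conj: "b \<otimes> a \<otimes> inv b = inv a"
    and gen: "\<And>H. subgroup H G \<Longrightarrow> a \<in> H \<Longrightarrow> b \<in> H \<Longrightarrow> carrier G \<subseteq> H"
    and o: "order G = 20"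
  shows "G \<cong> dicyclic_group_20"
proof -
  let ?D = dicyclic_group_20
  have "a [^] (5::nat) = \<one>" "b [^] (4::nat) = \<one>"
    using pow_ord_eq_1[OF a] pow_ord_eq_1[OF b] a5 b4 by simp_all
  then obtain h where h: "h \<in> hom ?D G" "h (1, 0) = a" "h (0, 1) = b"
    using dicyclic_universal[OF is_group a b _ _ conj] by blast
  interpret h: group_hom ?D G h
    using h(1) by (intro group_hom.intro group_dicyclic is_group group_hom_axioms.intro)
  have "(1, 0) \<in> carrier ?D" "(0, 1) \<in> carrier ?D" by (simp_all add: carrier_dicyclic)
  then have "a \<in> h ` carrier ?D" "b \<in> h ` carrier ?D" using h(2,3) by (metis imageI)+
  then have "carrier G \<subseteq> h ` carrier ?D" by (rule gen[OF h.img_is_subgroup])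
  then have img: "h ` carrier ?D = carrier G" using h.hom_closed by blast
  have "card (h ` carrier ?D) = card (carrier ?D)"
    unfolding img using o order_dicyclic by (simp add: order_def)
  moreover have "finite (carrier ?D)" by (simp add: carrier_dicyclic)
  ultimately have "inj_on h (carrier ?D)" by (simp add: eq_card_imp_inj_on)
  then have "h \<in> iso ?D G" using h(1) img by (simp add: iso_def bij_betw_def)
  then have "?D \<cong> G" by (rule is_isoI)
  then show ?thesis by (rule group.iso_sym[OF group_dicyclic])
qed

section \<open>Groups with at most two cyclic subgroups of order above 2\<close>

lemma involution_iff: "x \<in> carrier G \<Longrightarrow> ord x = 2 \<longleftrightarrow> x \<otimes> x = \<one> \<and> x \<noteq> \<one>"
proof -
  assume x: "x \<in> carrier G"
  have "x \<otimes> x = \<one> \<longleftrightarrow> ord x dvd 2" using pow_eq_id[OF x, of 2] x by (simp add: numeral_2_eq_2)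
  moreover have "ord x dvd 2 \<longleftrightarrow> ord x = 1 \<or> ord x = 2"
    using prime_nat_iff two_is_prime_nat by auto
  ultimately show ?thesis using ord_eq_1[OF x] by auto
qed

lemma generates_if_ord_eq_order:
  assumes w: "w \<in> carrier G" and o: "ord w = order G"
  shows "carrier G = cyc w"
proof -
  have "cyc w \<subseteq> carrier G" using cyc_in_carrier[OF w] by blast
  moreover have "card (cyc w) = card (carrier G)" using card_cyc[OF w] o by (simp add: order_def)
  ultimately show ?thesis using card_subset_eq[OF finite_carrier] by metis
qed

text \<open>If \<open>w [^] j\<close> squares to the identity, then \<open>2 * k\<close> divides
  \<open>2 * j\<close>; so every involution is a power of \<open>w [^] k\<close>, which itself has
  order 2.\<close>

lemma num_involutions_cyclic_le_1:
  assumes w: "w \<in> carrier G" and gen: "carrier G = cyc w" and o: "order G = 2 * k"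
  shows "num_involutions G \<le> 1"
proof -
  have ow: "ord w = 2 * k" using card_cyc[OF w] gen o by (simp add: order_def)
  have k: "k > 0" using ord_pos[OF w] ow by simp
  have ok: "ord (w [^] k) = 2" using ord_pow[OF w, of k] ow k by simp
  have wk: "w [^] k \<in> carrier G" using w by simp
  have "{x \<in> carrier G. ord x = 2} \<subseteq> {w [^] k}"
  proof
    fix u assume "u \<in> {x \<in> carrier G. ord x = 2}"
    then have u: "u \<in> carrier G" "ord u = 2" by auto
    then obtain j :: nat where j: "u = w [^] j" using mem_cyc_iff[OF w] gen by blast
    have "u [^] (2::nat) = \<one>" using pow_ord_eq_1[OF u(1)] unfolding u(2) .
    then have "w [^] (j * 2) = \<one>" unfolding j nat_pow_pow[OF w] .
    then have "k dvd j" using pow_eq_id[OF w, of "j * 2"] ow by (simp add: mult.commute)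
    then obtain i where i: "j = k * i" by blast
    have "u = (w [^] k) [^] i" using j i w by (simp add: nat_pow_pow)
    then have ui: "u = (w [^] k) [^] (i mod 2)" using pow_mod_ord[OF wk, of i] ok by simp
    have "i mod 2 \<noteq> 0"
    proof
      assume "i mod 2 = 0"
      then have "u = \<one>" using ui by simp
      then show False using u(2) by simp
    qed
    then have "i mod 2 = 1" by simp
    then show "u \<in> {w [^] k}" using ui wk by simp
  qed
  then show ?thesis unfolding num_involutions_def using card_mono[of "{w [^] k}"] by fastforce
qed

text \<open>This covers the order that \<open>totient_le_third\<close> leaves open. The square of
  \<open>y\<close> lies in \<open>cyc x\<close> and has odd order above 2, so it generates a big
  subgroup, which can only be \<open>cyc x\<close>. Thus \<open>cyc x\<close> is properly contained
  in \<open>cyc y\<close>, and index 2 leaves no room except for \<open>G\<close>.\<close>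

lemma ord_order_if_index_2:
  assumes x: "x \<in> carrier G" and y: "y \<in> carrier G"
    and o: "order G = 2 * ord x" and odd: "odd (ord x)"
    and big: "big_cyclic_subgroups = {cyc x, cyc y}" and y2: "ord y > 2"
    and few: "num_involutions G < ord x"
  shows "ord y = order G"
proof -
  have cx: "card (cyc x) = ord x" by (rule card_cyc[OF x])
  have sub: "cyc x \<subseteq> carrier G" using cyc_in_carrier[OF x] by blast
  have ynx: "y \<notin> cyc x"
  proof
    assume yx: "y \<in> cyc x"
    \<comment> \<open>With \<open>y\<close> in \<open>cyc x\<close>, both big subgroups would lie
      inside \<open>cyc x\<close>, and the other half of \<open>G\<close> would consist of
      involutions, against \<open>few\<close>.\<close>
    have "carrier G - cyc x \<subseteq> {v \<in> carrier G. ord v = 2}"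
    proof
      fix v assume v: "v \<in> carrier G - cyc x"
      then have vc: "v \<in> carrier G" by simp
      have "ord v \<noteq> 1" using v ord_eq_1[OF vc] generate.one by auto
      moreover have "\<not> ord v > 2"
      proof
        assume "ord v > 2"
        then have "cyc v = cyc x \<or> cyc v = cyc y" using cyc_big[OF vc] big by blast
        then show False using cyc_self[of v] cyc_mono[OF x yx] v by blast
      qed
      ultimately show "v \<in> {v \<in> carrier G. ord v = 2}" using vc ord_pos[OF vc] by simp
    qed
    then have "card (carrier G - cyc x) \<le> num_involutions G"
      unfolding num_involutions_def by (rule card_mono[rotated]) (simp add: finite_carrier)
    moreover have "card (carrier G - cyc x) = ord x"
      using card_Diff_subset[OF finite_cyc[OF x] sub] cx o by (simp add: order_def)
    ultimately show False using few by simp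
  qed
  let ?w = "y \<otimes> y"
  have w: "?w \<in> carrier G" using y by simp
  have wx: "?w \<in> cyc x"
  proof (rule ccontr)
    assume nw: "?w \<notin> cyc x"
    \<comment> \<open>By index 2 this coset is the complement of \<open>cyc x\<close>; if it
      contained the square of \<open>y\<close>, cancelling \<open>y\<close> would put
      \<open>y\<close> into \<open>cyc x\<close>.\<close>
    let ?Y = "(\<lambda>v. y \<otimes> v) ` cyc x"
    have "inj_on (\<lambda>v. y \<otimes> v) (cyc x)"
      using y cyc_in_carrier[OF x] by (intro inj_onI) simp
    then have cY: "card ?Y = ord x" using card_image cx by metis
    have disj: "cyc x \<inter> ?Y = {}"
    proof (rule equals0I)
      fix v assume "v \<in> cyc x \<inter> ?Y"
      then obtain u where "u \<in> cyc x" "y \<otimes> u \<in> cyc x" by blast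
      then show False using cyc_mult_right[OF x _ y] ynx by blast
    qed
    have "card (cyc x \<union> ?Y) = card (carrier G)"
      using card_Un_disjoint[OF finite_cyc[OF x] _ disj] finite_cyc[OF x] cY cx o by (simp add: order_def)
    moreover have "cyc x \<union> ?Y \<subseteq> carrier G" using sub y cyc_in_carrier[OF x] by blast
    ultimately have "cyc x \<union> ?Y = carrier G" using card_subset_eq[OF finite_carrier] by blast
    then have "?w \<in> ?Y" using w nw by blast
    then obtain u where u: "u \<in> cyc x" "y \<otimes> y = y \<otimes> u" by blast
    have "y = u" by (rule l_cancel[OF u(2) y cyc_in_carrier[OF x u(1)] y])
    then show False using u ynx by simp
  qed
  have "ord ?w dvd ord x" by (rule ord_dvd_of_mem_cyc[OF x wx])
  then have "odd (ord ?w)" using odd dvd_trans by blast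
  moreover have "ord ?w \<noteq> 1"
  proof
    assume "ord ?w = 1"
    then have "y \<otimes> y = \<one>" using ord_eq_1[OF w] by simp
    then have "ord y dvd 2" using pow_eq_id[OF y, of 2] y by (simp add: numeral_2_eq_2)
    then show False using y2 dvd_imp_le by fastforce
  qed
  ultimately have "ord ?w > 2" using ord_pos[OF w] by presburger
  then have "cyc ?w = cyc x \<or> cyc ?w = cyc y" using cyc_big[OF w] big by blast
  moreover have "cyc ?w \<noteq> cyc y" using cyc_mono[OF x wx] cyc_self[of y] ynx by blast
  ultimately have "cyc x = cyc ?w" by simp
  moreover have "?w \<in> cyc y" by (intro cyc_mult cyc_self)
  ultimately have "cyc x \<subseteq> cyc y" using cyc_mono[OF y] by blast
  then have "cyc x \<subset> cyc y" using ynx cyc_self[of y] by blast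
  then have lt: "ord x < ord y" using psubset_card_mono[OF finite_cyc[OF y]] card_cyc x y by metis
  obtain q where q: "2 * ord x = ord y * q" using ord_dvd_group_order[OF y] o by auto
  have "q < 2"
  proof (rule ccontr)
    assume "\<not> q < 2"
    then have "ord y * 2 \<le> ord y * q" by simp
    then show False using q lt by linarith
  qed
  moreover have "q \<noteq> 0" using q ord_pos[OF x] by (auto intro: ccontr)
  ultimately have "q = 1" by linarith
  then show ?thesis using q o by simp
qed

text \<open>If no element generates \<open>G\<close>, neither big subgroup has order
  \<open>2 * k\<close>, and order \<open>k\<close> is excluded by
  \<open>ord_order_if_index_2\<close>. Then both totients are at most a third of \<open>k\<close>,
  too small for their sum \<open>k + 3\<close>.\<close>

lemma two_big_imp_cyclic:
  assumes big: "card big_cyclic_subgroups = 2"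
    and o: "order G = 2 * k" and k: "odd k" and t: "k = num_involutions G + 4"
  shows "\<exists>w \<in> carrier G. ord w = order G"
proof (rule ccontr)
  assume no: "\<not> ?thesis"
  obtain C D where CD: "big_cyclic_subgroups = {C, D}" "C \<noteq> D"
    using big by (auto simp: card_2_iff)
  then have "C \<in> big_cyclic_subgroups" "D \<in> big_cyclic_subgroups" by auto
  then obtain x y where x: "x \<in> carrier G" "C = cyc x" "ord x > 2"
    and y: "y \<in> carrier G" "D = cyc y" "ord y > 2"
    unfolding big_iff by blast
  have "order G = 1 + num_involutions G + (totient (ord x) + totient (ord y))"
    using order_eq_sum_totient CD card_cyc x y by simp
  then have sum: "totient (ord x) + totient (ord y) = k + 3" using o t by simp
  have dvd: "ord x dvd 2 * k" "ord y dvd 2 * k"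
    using ord_dvd_group_order[OF x(1)] ord_dvd_group_order[OF y(1)] o by simp_all
  have ne: "ord x \<noteq> 2 * k" "ord y \<noteq> 2 * k" using no o x y by auto
  have "ord x \<noteq> k"
  proof
    assume xk: "ord x = k"
    then have "ord y = order G"
      using ord_order_if_index_2[OF x(1) y(1)] o k t CD x(2) y(2,3) by simp
    then show False using no y(1) by blast
  qed
  moreover have "ord y \<noteq> k"
  proof
    assume yk: "ord y = k"
    then have "ord x = order G"
      using ord_order_if_index_2[OF y(1) x(1)] o k t CD x(2,3) y(2) by (simp add: insert_commute)
    then show False using no x(1) by blast
  qed
  ultimately have "3 * totient (ord x) \<le> k" "3 * totient (ord y) \<le> k"
    using totient_le_third[OF k] dvd ne by blast+
  then show False using sum by linarith
qed

text \<open>The count forces the totient of the only big subgroup to be half of the group order plus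
  2. No proper subgroup is large enough for that, and the whole group, being of even order, has
  totient at most half its order.\<close>

lemma not_one_big:
  assumes one: "card big_cyclic_subgroups = 1"
    and o: "order G = 2 * num_involutions G + 6"
  shows False
proof -
  obtain C where C: "big_cyclic_subgroups = {C}" using one by (rule card_1_singletonE)
  then obtain x where x: "x \<in> carrier G" "C = cyc x" using big_iff by blast
  have "order G = 1 + num_involutions G + totient (ord x)"
    using order_eq_sum_totient C card_cyc[OF x(1)] x(2) by simp
  then have tot: "2 * totient (ord x) = order G + 4" using o by simp
  obtain q where q: "order G = ord x * q" using ord_dvd_group_order[OF x(1)] by blast
  have "q < 2"
  proof (rule ccontr)
    assume "\<not> q < 2"
    then have "ord x * 2 \<le> ord x * q" by simp
    then show False using q tot totient_le[of "ord x"] by linarith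
  qed
  moreover have "q \<noteq> 0" using q o by (auto intro: ccontr)
  ultimately have "q = 1" by linarith
  then have "ord x = order G" using q by simp
  moreover have "even (order G)" using o by simp
  ultimately show False using totient_even_le_half[of "ord x"] tot by simp
qed

end

section \<open>Involutions and isomorphism\<close>

text \<open>This form avoids element orders: it transfers along isomorphisms directly and can be
  evaluated in concrete groups.\<close>

lemma num_involutions_eq:
  fixes G (structure)
  assumes "group G" "finite (carrier G)"
  shows "num_involutions G = card {x \<in> carrier G. x \<otimes> x = \<one> \<and> x \<noteq> \<one>}"
proof -
  interpret finite_group G using assms by (simp add: finite_group_def finite_group_axioms_def)
  have "{x \<in> carrier G. ord x = 2} = {x \<in> carrier G. x \<otimes> x = \<one> \<and> x \<noteq> \<one>}"
    using involution_iff by blast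
  then show ?thesis unfolding num_involutions_def by simp
qed

lemma num_involutions_iso:
  assumes G: "group G" "finite (carrier G)" and H: "group H" and iso: "G \<cong> H"
  shows "num_involutions G = num_involutions H"
proof -
  obtain h where h: "h \<in> iso G H" using iso unfolding is_iso_def by blast
  then have hom: "h \<in> hom G H" and bij: "bij_betw h (carrier G) (carrier H)" by (simp_all add: iso_def)
  interpret h: group_hom G H h
    using hom G H by (intro group_hom.intro group_hom_axioms.intro)
  have fH: "finite (carrier H)" using bij_betw_finite[OF bij] G(2) by simp
  have one: "h x = \<one>\<^bsub>H\<^esub> \<longleftrightarrow> x = \<one>\<^bsub>G\<^esub>" if "x \<in> carrier G" for x
    using inj_onD[OF bij_betw_imp_inj_on[OF bij] _ that h.G.one_closed] h.hom_one by auto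
  let ?I = "{x \<in> carrier G. x \<otimes>\<^bsub>G\<^esub> x = \<one>\<^bsub>G\<^esub> \<and> x \<noteq> \<one>\<^bsub>G\<^esub>}"
  let ?J = "{x \<in> carrier H. x \<otimes>\<^bsub>H\<^esub> x = \<one>\<^bsub>H\<^esub> \<and> x \<noteq> \<one>\<^bsub>H\<^esub>}"
  have iff: "h x \<in> ?J \<longleftrightarrow> x \<in> ?I" if "x \<in> carrier G" for x
    using one[OF that] one[of "x \<otimes>\<^bsub>G\<^esub> x"] that by simp
  have "h ` ?I = ?J"
  proof (intro equalityI subsetI)
    fix y assume y: "y \<in> ?J"
    then obtain x where x: "x \<in> carrier G" "y = h x" using bij unfolding bij_betw_def by blast
    then show "y \<in> h ` ?I" using iff y by blast
  next
    fix y assume "y \<in> h ` ?I"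
    then obtain x where x: "x \<in> ?I" "y = h x" by (rule imageE)
    then have "x \<in> carrier G" by blast
    from iff[OF this] x show "y \<in> ?J" by metis
  qed
  moreover have "inj_on h ?I" by (rule inj_on_subset[OF bij_betw_imp_inj_on[OF bij]]) blast
  then have "card (h ` ?I) = card ?I" by (rule card_image)
  ultimately have "card ?I = card ?J" by simp
  then show ?thesis using num_involutions_eq[OF G] num_involutions_eq[OF H fH] by simp
qed

lemma num_involutions_integer_mod_group_10: "num_involutions (integer_mod_group 10) = 1"
proof -
  have five: "x = 5" if x: "0 \<le> x" "x < 10" "(x + x) mod 10 = 0" "x \<noteq> 0" for x :: int
  proof -
    obtain k where "x + x = 10 * k" using x(3) by (metis dvdE dvd_eq_mod_eq_0)
    then show ?thesis using x(1,2,4) by presburger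
  qed
  have "{x \<in> carrier (integer_mod_group 10). x \<otimes>\<^bsub>integer_mod_group 10\<^esub> x = \<one>\<^bsub>integer_mod_group 10\<^esub>
      \<and> x \<noteq> \<one>\<^bsub>integer_mod_group 10\<^esub>} = {5}"
    using five by (auto simp: carrier_integer_mod_group)
  then show ?thesis
    using num_involutions_eq[OF group_integer_mod_group, of 10] by (simp add: carrier_integer_mod_group)
qed

lemma num_involutions_dicyclic_group_20: "num_involutions dicyclic_group_20 = 1"
proof -
  let ?D = dicyclic_group_20
  have "{x \<in> carrier ?D. x \<otimes>\<^bsub>?D\<^esub> x = \<one>\<^bsub>?D\<^esub> \<and> x \<noteq> \<one>\<^bsub>?D\<^esub>} = {(0, 2)}"
  proof (intro equalityI subsetI)
    fix x assume x: "x \<in> {x \<in> carrier ?D. x \<otimes>\<^bsub>?D\<^esub> x = \<one>\<^bsub>?D\<^esub> \<and> x \<noteq> \<one>\<^bsub>?D\<^esub>}"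
    obtain i j where ij: "x = (i, j)" by (cases x)
    have ran: "0 \<le> i" "i < 5" "0 \<le> j" "j < 4" using x by (auto simp: ij carrier_dicyclic)
    then have "(if even j then i + i else i - i) mod 5 = 0" "(j + j) mod 4 = 0" "i \<noteq> 0 \<or> j \<noteq> 0"
      using x by (auto simp: ij mult_dicyclic one_dicyclic)
    moreover have "i = 0 \<or> i = 1 \<or> i = 2 \<or> i = 3 \<or> i = 4" "j = 0 \<or> j = 1 \<or> j = 2 \<or> j = 3"
      using ran by presburger+
    ultimately have "i = 0 \<and> j = 2" by fastforce
    then show "x \<in> {(0, 2)}" using ij by simp
  qed (auto simp: carrier_dicyclic mult_dicyclic one_dicyclic)
  then show ?thesis
    using num_involutions_eq[OF group_dicyclic] by (simp add: carrier_dicyclic)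
qed

section \<open>Groups with a unique involution\<close>

text \<open>\<open>sum_totient_big\<close> is the form which the hypothesis \<open>|C(G)| = |G|/2 - 1\<close> takes for a single involution.\<close>
locale unique_involution = finite_group +
  fixes z
  assumes z_closed: "z \<in> carrier G" and ord_z: "ord z = 2"
    and involution_unique: "\<And>x. x \<in> carrier G \<Longrightarrow> ord x = 2 \<Longrightarrow> x = z"
    and sum_totient_big: "(\<Sum>C\<in>big_cyclic_subgroups. totient (card C)) = 2 * card big_cyclic_subgroups + 4"
begin

section \<open>The central involution and square roots\<close>

lemma z_commutes: "x \<in> carrier G \<Longrightarrow> x \<otimes> z = z \<otimes> x"
  using involution_unique[of "x \<otimes> z \<otimes> inv x"] ord_conj[of x z] conj_eq_self_iff[of x z] z_closed ord_z
  by simp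

lemma z_square: "z [^] (2::nat) = \<one>" "z \<otimes> z = \<one>"
  using pow_ord_eq_1[OF z_closed] z_closed by (auto simp: ord_z numeral_2_eq_2)

lemma square_one:
  assumes "u \<in> carrier G" "u [^] (2::nat) = \<one>"
  shows "u = \<one> \<or> u = z"
proof -
  have "ord u dvd 2" using assms pow_eq_id by simp
  then have "ord u = 1 \<or> ord u = 2" using prime_nat_iff two_is_prime_nat by blast
  then show ?thesis using assms(1) ord_eq_1 involution_unique by auto
qed

text \<open>For commuting elements the quotient of \<open>p\<close> by \<open>q\<close> squares to
  the identity, so it is trivial or equal to \<open>z\<close>.\<close>

lemma square_eq:
  assumes p: "p \<in> carrier G" and q: "q \<in> carrier G" and pq: "p \<otimes> q = q \<otimes> p"
    and sq: "p [^] (2::nat) = q [^] (2::nat)"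
  shows "p = q \<or> p = q \<otimes> z"
proof -
  have c: "p \<otimes> inv q = inv q \<otimes> p" using p q pq by (metis inv_closed inv_solve_left inv_solve_right m_assoc m_closed)
  have "(p \<otimes> inv q) [^] (2::nat) = p [^] (2::nat) \<otimes> (inv q) [^] (2::nat)"
    using pow_mult_distrib[OF c] p q by simp
  also have "\<dots> = \<one>" using p q sq by (simp add: nat_pow_inv)
  finally have "p \<otimes> inv q = \<one> \<or> p \<otimes> inv q = z" using p q by (intro square_one) auto
  moreover have "p = (p \<otimes> inv q) \<otimes> q" using p q by (simp add: m_assoc)
  ultimately have "p = \<one> \<otimes> q \<or> p = z \<otimes> q" by fastforce
  then show ?thesis using q z_commutes[OF q] by fastforce
qed

lemma half_order:
  assumes x: "x \<in> carrier G" and o: "ord x = 2 * k" and k: "k > 0"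
  shows "x [^] k = z"
proof (rule involution_unique)
  show "ord (x [^] k) = 2" using ord_pow[OF x, of k] o k by simp
qed (simp add: x)

section \<open>Bounds on totients and the possible element orders\<close>

lemma sum_totient_le:
  assumes "F \<subseteq> big_cyclic_subgroups"
  shows "(\<Sum>C\<in>F. totient (card C)) \<le> 2 * card F + 4"
proof -
  let ?B = "big_cyclic_subgroups"
  have fF: "finite F" using assms finite_big finite_subset by blast
  have "(\<Sum>C\<in>?B. totient (card C)) = (\<Sum>C\<in>F. totient (card C)) + (\<Sum>C\<in>?B - F. totient (card C))"
    using sum.subset_diff[OF assms finite_big, of "\<lambda>C. totient (card C)"] by simp
  \<comment> \<open>Each big subgroup outside \<open>F\<close> already uses up its share of 2, so
    the total excess available to \<open>F\<close> is 4.\<close>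
  moreover have "(\<Sum>C\<in>?B - F. 2) \<le> (\<Sum>C\<in>?B - F. totient (card C))"
    by (rule sum_mono) (simp add: totient_big_ge_2)
  moreover have "card (?B - F) = card ?B - card F" using card_Diff_subset[OF fF assms] .
  moreover have "card F \<le> card ?B" using card_mono[OF finite_big assms] .
  ultimately show ?thesis using sum_totient_big by simp
qed

lemma totient_ord_le_6: "x \<in> carrier G \<Longrightarrow> totient (ord x) \<le> 6"
proof (cases "ord x > 2")
  case True
  moreover assume "x \<in> carrier G"
  ultimately show ?thesis using sum_totient_le[of "{cyc x}"] cyc_big[of x] by (simp add: card_cyc)
next
  case False
  then show ?thesis using totient_le[of "ord x"] by linarith
qed

lemma totient_ord_two_le_8:
  assumes "x \<in> carrier G" "y \<in> carrier G" "ord x > 2" "ord y > 2" "cyc x \<noteq> cyc y"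
  shows "totient (ord x) + totient (ord y) \<le> 8"
  using sum_totient_le[of "{cyc x, cyc y}"] assms by (simp add: card_cyc cyc_big)

lemma totient_ord_three_le_10:
  assumes "x \<in> carrier G" "y \<in> carrier G" "w \<in> carrier G" "ord x > 2" "ord y > 2" "ord w > 2"
    "cyc x \<noteq> cyc y" "cyc x \<noteq> cyc w" "cyc y \<noteq> cyc w"
  shows "totient (ord x) + totient (ord y) + totient (ord w) \<le> 10"
  using sum_totient_le[of "{cyc x, cyc y, cyc w}"] assms by (simp add: card_cyc cyc_big)

lemma ord_mult_z: "x \<in> carrier G \<Longrightarrow> odd (ord x) \<Longrightarrow> ord (x \<otimes> z) = 2 * ord x"
  using ord_mult_coprime[of x z] z_closed ord_z z_commutes by simp

text \<open>Multiplication by \<open>z\<close> doubles the order and preserves the totient;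
  \<open>x\<close> and \<open>x \<otimes> z\<close> thus generate two big subgroups that share the
  bound 8.\<close>

lemma totient_odd_ord_le_4:
  assumes x: "x \<in> carrier G" and o: "odd (ord x)"
  shows "totient (ord x) \<le> 4"
proof (cases "ord x > 2")
  case True
  have o2: "ord (x \<otimes> z) = 2 * ord x" by (rule ord_mult_z[OF x o])
  have "ord x \<noteq> ord (x \<otimes> z)" using o2 True by simp
  then have "cyc x \<noteq> cyc (x \<otimes> z)" using x z_closed generate_pow_card by (metis m_closed)
  then have "totient (ord x) + totient (ord (x \<otimes> z)) \<le> 8"
    using totient_ord_two_le_8[of x "x \<otimes> z"] x z_closed True o2 by simp
  then show ?thesis using o2 o by (simp add: totient_double)
next
  case False
  then show ?thesis using totient_le[of "ord x"] by linarith
qed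

lemma ord_cases:
  assumes x: "x \<in> carrier G"
  shows "ord x \<in> {1,2,3,4,5,6,8,10,12}"
proof (rule totient_le_6_cases[OF ord_pos[OF x] totient_ord_le_6[OF x]])
  \<comment> \<open>A divisor \<open>d\<close> of \<open>ord x\<close> is the order of a suitable
    power of \<open>x\<close>; if \<open>d\<close> is odd, its totient 6 exceeds the bound
    4.\<close>
  have *: False if d: "d dvd ord x" "odd d" "totient d = 6" for d
  proof -
    obtain k where k: "ord x = d * k" using d(1) by blast
    have "k \<noteq> 0" "d \<noteq> 0" using k ord_pos[OF x] by (auto intro: ccontr)
    then have "ord (x [^] k) = d" using ord_pow[OF x, of k] k by simp
    then show False using totient_odd_ord_le_4[of "x [^] k"] d x by simp
  qed
  show "\<not> 7 dvd ord x" "\<not> 9 dvd ord x"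
    using *[of 7] *[of 9] totient_7 totient_9 by auto
qed

lemma totient_ord_eq_4_iff: "x \<in> carrier G \<Longrightarrow> totient (ord x) = 4 \<longleftrightarrow> ord x \<in> {5,8,10,12}"
  and totient_ord_cases: "x \<in> carrier G \<Longrightarrow> ord x > 2 \<Longrightarrow> totient (ord x) = 2 \<or> totient (ord x) = 4"
  using ord_cases[of x] totient_3 totient_5 totient_8 totient_10 totient_12 by auto

text \<open>Every big subgroup has totient 2 or 4, so the total excess of 4 in
  \<open>sum_totient_big\<close> comes from exactly two subgroups of totient 4.\<close>

lemma obtain_pair:
  obtains x y where "x \<in> carrier G" "y \<in> carrier G" "ord x \<in> {5,8,10,12}" "ord y \<in> {5,8,10,12}"
    "cyc x \<noteq> cyc y" "\<And>w. w \<in> carrier G \<Longrightarrow> ord w \<in> {5,8,10,12} \<Longrightarrow> cyc w = cyc x \<or> cyc w = cyc y"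
proof -
  let ?B = "big_cyclic_subgroups"
  let ?F = "{C \<in> ?B. totient (card C) = 4}"
  have "(\<Sum>C\<in>?B. totient (card C)) = (\<Sum>C\<in>?B. 2 + (if totient (card C) = 4 then 2 else 0))"
  proof (rule sum.cong[OF refl])
    fix C assume "C \<in> ?B"
    then have "totient (card C) = 2 \<or> totient (card C) = 4"
      using totient_ord_cases big_iff card_cyc by metis
    then show "totient (card C) = 2 + (if totient (card C) = 4 then 2 else 0)" by auto
  qed
  also have "\<dots> = 2 * card ?B + 2 * card ?F"
    by (simp only: sum.distrib sum.inter_filter[OF finite_big, symmetric] sum_constant) simp
  finally have "card ?F = 2" using sum_totient_big by simp
  then obtain C D where CD: "?F = {C, D}" "C \<noteq> D" by (auto simp: card_2_iff)
  then have "C \<in> ?F" "D \<in> ?F" by auto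
  then obtain x y where xy: "x \<in> carrier G" "y \<in> carrier G" "C = cyc x" "D = cyc y"
      "totient (ord x) = 4" "totient (ord y) = 4"
    using big_iff card_cyc by (metis (mono_tags, lifting) mem_Collect_eq)
  show ?thesis
  proof (rule that[OF xy(1,2)])
    show "ord x \<in> {5,8,10,12}" "ord y \<in> {5,8,10,12}" using totient_ord_eq_4_iff xy by auto
    show "cyc x \<noteq> cyc y" using CD xy by simp
    fix w assume w: "w \<in> carrier G" "ord w \<in> {5,8,10,12}"
    then have "cyc w \<in> ?F" using totient_ord_eq_4_iff[OF w(1)] cyc_big[OF w(1)] card_cyc[OF w(1)]
      by auto
    then show "cyc w = cyc x \<or> cyc w = cyc y" using CD xy by auto
  qed
qed

section \<open>Excluding two subgroups of order 8 or 12\<close>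

lemma z_in_cyc: "y \<in> carrier G \<Longrightarrow> even (ord y) \<Longrightarrow> z \<in> cyc y"
  using half_order[of y "ord y div 2"] ord_pos[of y] cyc_pow[OF _ cyc_self, of y "ord y div 2"] by auto

text \<open>Conjugation by \<open>x\<close> fixes the common square, so it maps \<open>y\<close> to
  \<open>y\<close> or \<open>y \<otimes> z\<close>. In the first case \<open>x\<close> and
  \<open>y\<close> commute and differ at most by \<open>z\<close>; in the second,
  \<open>x \<otimes> y\<close> squares to the identity. Either way \<open>x\<close> falls into
  \<open>cyc y\<close>.\<close>

lemma no_order_8_pair_aux:
  assumes x: "x \<in> carrier G" and y: "y \<in> carrier G" and oy: "ord y = 8"
    and xy: "x \<notin> cyc y" and c: "x \<otimes> y \<otimes> inv x \<in> cyc y"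
    and sq: "x [^] (2::nat) = y [^] (2::nat)"
  shows False
proof -
  have zy: "z \<in> cyc y" using z_in_cyc[OF y] oy by simp
  have sqs: "x \<otimes> x = y \<otimes> y" using sq x y by (simp add: numeral_2_eq_2)
  have y4: "y [^] (4::nat) = z" using half_order[OF y, of 4] oy by simp
  let ?p = "x \<otimes> y \<otimes> inv x"
  have p: "?p \<in> carrier G" using x y by simp
  have "x \<otimes> y [^] (2::nat) \<otimes> inv x = x [^] (2::nat)"
    using x unfolding sq[symmetric] by (simp add: numeral_2_eq_2 m_assoc)
  then have "?p [^] (2::nat) = y [^] (2::nat)"
    using conj_pow[OF x y, of 2] sq by simp
  moreover obtain k :: nat where k: "?p = y [^] k" using c mem_cyc_iff[OF y] by blast
  have "?p \<otimes> y = y \<otimes> ?p" unfolding k using pow_commute[OF y y refl, of k 1] y by simp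
  ultimately consider "?p = y" | "?p = y \<otimes> z" using square_eq[OF p y] by blast
  then show False
  proof cases
    case 1
    then have "x \<otimes> y = y \<otimes> x" using conj_eq_self_iff[OF x y] by simp
    then have "x = y \<or> x = y \<otimes> z" using square_eq[OF x y _ sq] by blast
    then show False using xy cyc_self[of y] cyc_mult[OF cyc_self zy] by blast
  next
    case 2
    have "x \<otimes> y = ?p \<otimes> x" using x y by (simp add: m_assoc)
    then have xy': "x \<otimes> y = z \<otimes> y \<otimes> x" using 2 z_commutes[OF y] by simp
    \<comment> \<open>Moving \<open>x\<close> past \<open>y\<close> costs one factor
      \<open>z\<close>, which cancels against the fourth power of \<open>y\<close>.\<close>
    have "(x \<otimes> y) [^] (2::nat) = (x \<otimes> y) \<otimes> (x \<otimes> y)" using x y by (simp add: numeral_2_eq_2)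
    also have "\<dots> = (z \<otimes> y \<otimes> x) \<otimes> (x \<otimes> y)" by (subst (1) xy') simp
    also have "\<dots> = z \<otimes> y \<otimes> (x \<otimes> x) \<otimes> y" using x y z_closed by (simp add: m_assoc)
    also have "\<dots> = z \<otimes> (y \<otimes> y \<otimes> y \<otimes> y)" unfolding sqs using y z_closed by (simp add: m_assoc)
    also have "y \<otimes> y \<otimes> y \<otimes> y = y [^] (4::nat)" using y by (simp add: numeral_eq_Suc)
    also have "z \<otimes> y [^] (4::nat) = \<one>" unfolding y4 by (rule z_square)
    finally have "x \<otimes> y = \<one> \<or> x \<otimes> y = z" using x y by (intro square_one) auto
    then have "x \<otimes> y \<in> cyc y" using zy generate.one by metis
    then show False using cyc_mult_right[OF y cyc_self x] xy by simp
  qed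
qed

text \<open>The squares of \<open>x\<close> and \<open>y\<close> commute and both square to
  \<open>z\<close>, so they agree up to the factor \<open>z\<close>.\<close>

lemma no_order_8_pair:
  assumes x: "x \<in> carrier G" and y: "y \<in> carrier G" and o: "ord x = 8" "ord y = 8"
    and ne: "cyc x \<noteq> cyc y" and c: "x \<otimes> y \<otimes> inv x \<in> cyc y"
  shows False
proof -
  have xy: "x \<notin> cyc y" using cyc_eq[OF y, of x] o ne by auto
  have comm: "x [^] (2::nat) \<otimes> y = y \<otimes> x [^] (2::nat)"
    using conj_square_commutes[OF x y _ c] o by simp
  have comm2: "x [^] (2::nat) \<otimes> y [^] (2::nat) = y [^] (2::nat) \<otimes> x [^] (2::nat)"
    using pow_commute[OF nat_pow_closed[OF x] y comm, of 1 2] x by simp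
  have y4: "y [^] (4::nat) = z" using half_order[OF y, of 4] o by simp
  have x4: "x [^] (4::nat) = z" using half_order[OF x, of 4] o by simp
  have "(x [^] (2::nat)) [^] (2::nat) = (y [^] (2::nat)) [^] (2::nat)"
    using x y x4 y4 by (simp add: nat_pow_pow)
  then consider "x [^] (2::nat) = y [^] (2::nat)" | "x [^] (2::nat) = y [^] (2::nat) \<otimes> z"
    using square_eq comm2 x y by blast
  then show False
  proof cases
    case 1
    then show False by (rule no_order_8_pair_aux[OF x y o(2) xy c])
  next
    case 2
    \<comment> \<open>Since \<open>z\<close> is the fourth power of \<open>y\<close>, the factor
      \<open>z\<close> turns the square of \<open>y\<close> into its sixth power, the square of
      \<open>?w\<close>. Replacing \<open>y\<close> by this generator of the same subgroup gives
      equal squares.\<close>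
    let ?w = "y [^] (3::nat)"
    have w: "?w \<in> carrier G" using y by simp
    have "coprime 3 (8::nat)" by code_simp
    then have ow: "ord ?w = 8" using pow_ord_eq_ord_iff[OF finite_carrier y, of 3] o by simp
    have wy: "?w \<in> cyc y" by (rule cyc_pow[OF y cyc_self])
    have cw: "cyc ?w = cyc y" using cyc_eq[OF y wy] ow o by simp
    have "y [^] (2::nat) \<otimes> z = y [^] (6::nat)" unfolding y4[symmetric] using y by (simp add: nat_pow_mult)
    also have "\<dots> = ?w [^] (2::nat)" using y by (simp add: nat_pow_pow)
    finally have sq: "x [^] (2::nat) = ?w [^] (2::nat)" using 2 by simp
    have "x \<otimes> ?w \<otimes> inv x \<in> cyc y" unfolding conj_pow[OF x y] by (rule cyc_pow[OF y c])
    then show False using no_order_8_pair_aux[OF x w ow _ _ sq] xy cw by simp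
  qed
qed

text \<open>The element \<open>w [^] 4\<close> of order 3 commutes with \<open>x\<close>, and the
  product would have the excluded order 24.\<close>

lemma no_order_8_12_pair:
  assumes x: "x \<in> carrier G" and w: "w \<in> carrier G" and o: "ord x = 8" "ord w = 12"
    and c: "w \<otimes> x \<otimes> inv w \<in> cyc x"
  shows False
proof -
  have "w [^] (2::nat) \<otimes> x = x \<otimes> w [^] (2::nat)"
    using conj_square_commutes[OF w x _ c] o by simp
  then have "(w [^] (2::nat)) [^] (2::nat) \<otimes> x [^] (1::nat) = x [^] (1::nat) \<otimes> (w [^] (2::nat)) [^] (2::nat)"
    using w x by (intro pow_commute) auto
  then have "x \<otimes> w [^] (4::nat) = w [^] (4::nat) \<otimes> x" using w x by (simp add: nat_pow_pow)
  moreover have "ord (w [^] (4::nat)) = 3" using ord_pow[OF w, of 4] o by simp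
  moreover have "coprime 8 (3::nat)" by code_simp
  ultimately have "ord (x \<otimes> w [^] (4::nat)) = 24" using ord_mult_coprime[OF x, of "w [^] (4::nat)"] w o by simp
  then show False using ord_cases[of "x \<otimes> w [^] (4::nat)"] x w by simp
qed

text \<open>The exponents 4 and 9 are the idempotents modulo 12: 4 is 1 modulo 3 and 0 modulo 4,
  while 9 is 0 modulo 3 and 1 modulo 4. They recover the two factors from the product.\<close>

lemma order_12_parts:
  assumes c: "c \<in> carrier G" and u: "u \<in> carrier G" and o: "ord c = 3" "ord u = 4"
    and cu: "c \<otimes> u = u \<otimes> c"
  shows "ord (c \<otimes> u) = 12" "c \<in> cyc (c \<otimes> u)" "u \<in> cyc (c \<otimes> u)"
proof -
  have "coprime 3 (4::nat)" by code_simp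
  then show "ord (c \<otimes> u) = 12" using ord_mult_coprime[OF c u cu] o by simp
  have cuc: "c \<otimes> u \<in> carrier G" using c u by simp
  have "(c \<otimes> u) [^] (4::nat) = c [^] (4::nat) \<otimes> u [^] (4::nat)" by (rule pow_mult_distrib[OF cu c u])
  also have "\<dots> = c"
    using pow_mod_ord[OF c, of 4] pow_mod_ord[OF u, of 4] o c u by simp
  finally show "c \<in> cyc (c \<otimes> u)" using cyc_pow[OF cuc cyc_self, of 4] by simp
  have "(c \<otimes> u) [^] (9::nat) = c [^] (9::nat) \<otimes> u [^] (9::nat)" by (rule pow_mult_distrib[OF cu c u])
  also have "c [^] (9::nat) = \<one>" using pow_mod_ord[OF c, of 9] o by simp
  also have "u [^] (9::nat) = u" using pow_mod_ord[OF u, of 9] o u by simp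
  also have "\<one> \<otimes> u = u" using u by simp
  finally show "u \<in> cyc (c \<otimes> u)" using cyc_pow[OF cuc cyc_self, of 9] by simp
qed

text \<open>A commuting product of elements of orders 3 and 4 generates one of the two given
  subgroups, which then contains both factors. Applied to the part of order 3 of \<open>x\<close>
  and the part of order 4 of \<open>y\<close>, this leaves two cases; in each, a second such product
  lies in the other subgroup and forces one subgroup into the other.\<close>

lemma no_order_12_pair:
  assumes x: "x \<in> carrier G" and y: "y \<in> carrier G" and o: "ord x = 12" "ord y = 12"
    and ne: "cyc x \<noteq> cyc y"
    and c: "x \<otimes> y \<otimes> inv x \<in> cyc y" "y \<otimes> x \<otimes> inv y \<in> cyc x"
    and only: "\<And>w. w \<in> carrier G \<Longrightarrow> ord w = 12 \<Longrightarrow> cyc w = cyc x \<or> cyc w = cyc y"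
  shows False
proof -
  txt \<open>Up to inverting the factor of order 4, \<open>x\<close> and \<open>y\<close> are the products of their parts of order 3 and 4.\<close>
  define a s b t where "a = x [^] (4::nat)" and "s = x [^] (3::nat)"
    and "b = y [^] (4::nat)" and "t = y [^] (3::nat)"
  have carr [simp]: "a \<in> carrier G" "s \<in> carrier G" "b \<in> carrier G" "t \<in> carrier G"
    using x y by (simp_all add: a_def s_def b_def t_def)
  have in_cyc: "a \<in> cyc x" "s \<in> cyc x" "b \<in> cyc y" "t \<in> cyc y"
    unfolding a_def s_def b_def t_def using x y by (simp_all add: cyc_pow cyc_self)
  have xy: "x \<notin> cyc y" and yx: "y \<notin> cyc x"
    using cyc_eq[OF y, of x] cyc_eq[OF x, of y] o ne by auto
  have "a = s \<otimes> x" "b = t \<otimes> y"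
    unfolding a_def s_def b_def t_def using x y by (simp_all add: numeral_eq_Suc)
  note sx = this
  have x_gen: "x \<in> cyc y" if "a \<in> cyc y" "s \<in> cyc y"
    using cyc_mult_left[OF y that(2) x] sx(1) that(1) by simp
  have y_gen: "y \<in> cyc x" if "b \<in> cyc x" "t \<in> cyc x"
    using cyc_mult_left[OF x that(2) y] sx(2) that(1) by simp
  have ord: "ord a = 3" "ord b = 3" "ord t = 4" "ord s = 4"
    unfolding a_def s_def b_def t_def using ord_pow[OF x, of 4] ord_pow[OF y, of 4]
      ord_pow[OF x, of 3] ord_pow[OF y, of 3] o by simp_all
  have s2: "s [^] (2::nat) = z" and t2: "t [^] (2::nat) = z"
    using half_order[of s 2] half_order[of t 2] ord by simp_all
  have comm_x2: "x [^] (2::nat) \<otimes> y = y \<otimes> x [^] (2::nat)"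
    using conj_square_commutes[OF x y _ c(1)] o by simp
  have comm_y2: "y [^] (2::nat) \<otimes> x = x \<otimes> y [^] (2::nat)"
    using conj_square_commutes[OF y x _ c(2)] o by simp
  have "a = (x [^] (2::nat)) [^] (2::nat)" unfolding a_def using x by (simp add: nat_pow_pow)
  then have ay: "a \<otimes> y = y \<otimes> a"
    using pow_commute[OF nat_pow_closed[OF x] y comm_x2, of 2 1] y by simp
  have "b = (y [^] (2::nat)) [^] (2::nat)" unfolding b_def using y by (simp add: nat_pow_pow)
  then have bx: "b \<otimes> x = x \<otimes> b"
    using pow_commute[OF nat_pow_closed[OF y] x comm_y2, of 2 1] x by simp
  have at: "a \<otimes> t = t \<otimes> a"
    unfolding t_def using pow_commute[OF carr(1) y ay, of 1 3] by simp
  have as: "a \<otimes> s = s \<otimes> a"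
    unfolding a_def s_def using pow_commute[OF x x refl] by blast
  have bt: "b \<otimes> t = t \<otimes> b"
    unfolding b_def t_def using pow_commute[OF y y refl] by blast
  have ab: "a \<otimes> b = b \<otimes> a"
    unfolding a_def using pow_commute[OF carr(3) x bx, of 1 4] by simp
  have parts: "c \<in> cyc (c \<otimes> u) \<and> u \<in> cyc (c \<otimes> u) \<and> (cyc (c \<otimes> u) = cyc x \<or> cyc (c \<otimes> u) = cyc y)"
    if "c \<in> carrier G" "u \<in> carrier G" "ord c = 3" "ord u = 4" "c \<otimes> u = u \<otimes> c" for c u
    using order_12_parts[OF that] only[of "c \<otimes> u"] that by simp
  note at_parts = parts[OF carr(1,4) ord(1,3) at]
  then consider "cyc (a \<otimes> t) = cyc x" | "cyc (a \<otimes> t) = cyc y" by blast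
  then show False
  proof cases
    case 1
    then have tx: "t \<in> cyc x" using at_parts by simp
    then have bnx: "b \<notin> cyc x" using y_gen yx by blast
    \<comment> \<open>The second product has the factors \<open>a \<otimes> b\<close> and
      \<open>t\<close>; by this line it cannot generate \<open>cyc x\<close>.\<close>
    have abx: "a \<otimes> b \<notin> cyc x" using cyc_mult_left[OF x in_cyc(1), of b] bnx by simp
    have abc: "a \<otimes> b \<in> carrier G" by simp
    have "(a \<otimes> b) [^] (3::nat) = a [^] ord a \<otimes> b [^] ord b"
      unfolding ord by (rule pow_mult_distrib[OF ab]) simp_all
    also have "\<dots> = \<one>" using pow_ord_eq_1[OF carr(1)] pow_ord_eq_1[OF carr(3)] by simp
    finally have "ord (a \<otimes> b) dvd 3" using pow_eq_id[OF abc, of 3] by simp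
    moreover have "a \<otimes> b \<noteq> \<one>" using abx generate.one by metis
    ultimately have oab: "ord (a \<otimes> b) = 3"
      using ord_eq_1[OF abc] prime_nat_iff[of 3] by auto
    have "(a \<otimes> b) \<otimes> t = t \<otimes> (a \<otimes> b)" using at bt
      by (metis carr(1,3,4) m_assoc)
    note abt = parts[OF abc carr(4) oab ord(3) this]
    then have "a \<otimes> b \<in> cyc y" using abx by auto
    then have "a \<in> cyc y" using cyc_mult_right[OF y in_cyc(3), of a] by simp
    then have "a \<otimes> t \<in> cyc y" using in_cyc(4) cyc_mult by blast
    then have "cyc (a \<otimes> t) \<subseteq> cyc y" by (rule cyc_mono[OF y])
    then show False using 1 cyc_self[of x] xy by blast
  next
    case 2
    then have a_y: "a \<in> cyc y" using at_parts by simp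
    then have sny: "s \<notin> cyc y" using x_gen xy by blast
    have zy: "z \<in> cyc y" using z_in_cyc[OF y] o by simp
    obtain k :: nat where k: "x \<otimes> y \<otimes> inv x = y [^] k" using c(1) mem_cyc_iff[OF y] by blast
    let ?q = "s \<otimes> t \<otimes> inv s"
    have "?q = (s \<otimes> y \<otimes> inv s) [^] (3::nat)" unfolding t_def by (rule conj_pow[OF carr(2) y])
    also have "s \<otimes> y \<otimes> inv s = y [^] (k ^ 3)" unfolding s_def by (rule conj_iterate[OF x y k])
    finally have "?q = (y [^] (k ^ 3)) [^] (3::nat)" .
    then have "?q = y [^] (k ^ 3 * 3)" using y by (simp add: nat_pow_pow)
    then have qt: "?q \<otimes> t = t \<otimes> ?q" unfolding t_def using pow_commute[OF y y refl] by metis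
    have "?q [^] (2::nat) = s \<otimes> z \<otimes> inv s" using conj_pow[of s t 2] t2 by simp
    also have "\<dots> = z" using conj_eq_self_iff[of s z] z_commutes[of s] z_closed by simp
    finally have q2: "?q [^] (2::nat) = t [^] (2::nat)" using t2 by simp
    \<comment> \<open>If \<open>s\<close> and \<open>t\<close> commute, they differ at most by
      \<open>z\<close>, which puts \<open>s\<close> into \<open>cyc y\<close>. Otherwise
      \<open>s \<otimes> t\<close> has order 4 and serves, together with \<open>a\<close>, as the
      second product.\<close>
    consider "?q = t" | "?q = t \<otimes> z" using square_eq[OF _ carr(4) qt q2] by auto
    then show False
    proof cases
      case 1
      then have "s \<otimes> t = t \<otimes> s" using conj_eq_self_iff[of s t] by simp
      then have "s = t \<or> s = t \<otimes> z" using square_eq[of s t] s2 t2 by simp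
      then show False using sny in_cyc(4) cyc_mult[OF in_cyc(4) zy] by blast
    next
      case q: 2
      have stc: "s \<otimes> t \<in> carrier G" by simp
      have "s \<otimes> t = ?q \<otimes> s" by (simp add: m_assoc)
      then have st: "s \<otimes> t = t \<otimes> z \<otimes> s" unfolding q .
      have "(s \<otimes> t) [^] (2::nat) = (s \<otimes> t) \<otimes> (s \<otimes> t)" by (simp add: numeral_2_eq_2)
      also have "\<dots> = (t \<otimes> z \<otimes> s) \<otimes> (s \<otimes> t)" by (subst (1) st) simp
      also have "\<dots> = t \<otimes> z \<otimes> (s [^] (2::nat)) \<otimes> t"
        using z_closed by (simp add: m_assoc numeral_2_eq_2)
      also have "\<dots> = t \<otimes> (z \<otimes> z) \<otimes> t" unfolding s2 using z_closed by (simp add: m_assoc)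
      also have "\<dots> = t [^] (2::nat)" unfolding z_square by (simp add: numeral_2_eq_2)
      finally have st2: "(s \<otimes> t) [^] (2::nat) = z" using t2 by simp
      have "(s \<otimes> t) [^] (4::nat) = ((s \<otimes> t) [^] (2::nat)) [^] (2::nat)"
        unfolding nat_pow_pow[OF stc] by simp
      then have "ord (s \<otimes> t) dvd 4" using st2 z_square pow_eq_id[OF stc, of 4] by simp
      moreover have "\<not> ord (s \<otimes> t) dvd 2"
        using st2 ord_z pow_eq_id[OF stc, of 2] by auto
      ultimately have "ord (s \<otimes> t) = 4"
        using ord_cases[OF stc] by auto
      moreover have "a \<otimes> (s \<otimes> t) = (s \<otimes> t) \<otimes> a" using as at
        by (metis carr(1,2,4) m_assoc)
      ultimately have ast: "a \<in> cyc (a \<otimes> (s \<otimes> t)) \<and> s \<otimes> t \<in> cyc (a \<otimes> (s \<otimes> t)) \<and>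
          (cyc (a \<otimes> (s \<otimes> t)) = cyc x \<or> cyc (a \<otimes> (s \<otimes> t)) = cyc y)"
        using parts[OF carr(1) stc ord(1)] by blast
      moreover have "s \<otimes> t \<notin> cyc y" using cyc_mult_right[OF y in_cyc(4), of s] sny by simp
      ultimately have "s \<otimes> t \<in> cyc x" by auto
      then have "t \<in> cyc x" using cyc_mult_left[OF x in_cyc(2), of t] by simp
      then have "a \<otimes> t \<in> cyc x" using in_cyc(1) cyc_mult by blast
      then have "cyc (a \<otimes> t) \<subseteq> cyc x" by (rule cyc_mono[OF x])
      then show False using 2 cyc_self[of y] yx by blast
    qed
  qed
qed

section \<open>An element of order 5 and its centralizer\<close>

lemma exists_order_5: "\<exists>a \<in> carrier G. ord a = 5"
proof (rule ccontr)
  assume no5: "\<not> ?thesis"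
  have no10: "ord w \<noteq> 10" if "w \<in> carrier G" for w
  proof
    assume "ord w = 10"
    then have "ord (w [^] (2::nat)) = 5" using ord_pow[OF that, of 2] by simp
    then show False using no5 that by (meson nat_pow_closed)
  qed
  obtain x y where x: "x \<in> carrier G" and y: "y \<in> carrier G"
    and o: "ord x \<in> {5,8,10,12}" "ord y \<in> {5,8,10,12}" and ne: "cyc x \<noteq> cyc y"
    and only: "\<And>w. w \<in> carrier G \<Longrightarrow> ord w \<in> {5,8,10,12} \<Longrightarrow> cyc w = cyc x \<or> cyc w = cyc y"
    by (rule obtain_pair) (rule that, assumption+)
  have o': "ord x \<in> {8, 12}" "ord y \<in> {8, 12}" using o no5 no10 x y by auto
  \<comment> \<open>Conjugation by \<open>p\<close> preserves orders, hence permutes the two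
    subgroups of totient 4. It fixes \<open>cyc p\<close>, so it must fix the other one.\<close>
  have conj: "p \<otimes> q \<otimes> inv p \<in> cyc q"
    if p: "p \<in> carrier G" and q: "q \<in> carrier G" and opq: "ord p \<in> {8, 12}" "ord q \<in> {8, 12}"
      and ne: "cyc p \<noteq> cyc q"
      and only: "\<And>w. w \<in> carrier G \<Longrightarrow> ord w \<in> {5,8,10,12} \<Longrightarrow> cyc w = cyc p \<or> cyc w = cyc q" for p q
  proof -
    let ?w = "p \<otimes> q \<otimes> inv p"
    have "ord ?w = ord q" by (rule ord_conj[OF p q])
    then have "cyc ?w = cyc p \<or> cyc ?w = cyc q" using only[of ?w] p q opq by auto
    moreover have "cyc ?w \<noteq> cyc p"
    proof
      assume "cyc ?w = cyc p"
      then have "?w \<in> cyc p" using cyc_self[of ?w] by simp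
      then have qp: "q \<in> cyc p" by (rule cyc_conj_mem[OF p q])
      then have "ord q dvd ord p" by (rule ord_dvd_of_mem_cyc[OF p])
      then have "ord q = ord p" using opq by auto
      then show False using cyc_eq[OF p qp] ne by simp
    qed
    ultimately have "cyc ?w = cyc q" by blast
    then show ?thesis using cyc_self[of ?w] by simp
  qed
  have cxy: "x \<otimes> y \<otimes> inv x \<in> cyc y" by (rule conj[OF x y o' ne only])
  have cyx: "y \<otimes> x \<otimes> inv y \<in> cyc x" using conj[OF y x o'(2,1)] ne only by metis
  consider "ord x = 8" "ord y = 8" | "ord x = 8" "ord y = 12" | "ord x = 12" "ord y = 8"
    | "ord x = 12" "ord y = 12" using o' by blast
  then show False
  proof cases
    case 1
    then show False using no_order_8_pair[OF x y _ _ ne cxy] by simp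
  next
    case 2
    then show False using no_order_8_12_pair[OF x y _ _ cyx] by simp
  next
    case 3
    then show False using no_order_8_12_pair[OF y x _ _ cxy] by simp
  next
    case 4
    then show False using no_order_12_pair[OF x y _ _ ne cxy cyx] only by simp
  qed
qed

text \<open>The two subgroups of totient 4 are those generated by \<open>a\<close> and
  \<open>a \<otimes> z\<close>, so an element outside has order 3, 4 or 6. If it commuted with
  \<open>a\<close>, an order 15 or 20 would arise. Otherwise it acts on \<open>cyc a\<close> by an
  exponent \<open>r\<close> other than 1 modulo 5, and its order restricts \<open>r\<close>.\<close>

lemma
  assumes a: "a \<in> carrier G" and a5: "ord a = 5"
  shows centralizer_ord_5: "\<And>y. y \<in> carrier G \<Longrightarrow> y \<otimes> a = a \<otimes> y \<Longrightarrow> y \<in> cyc (a \<otimes> z)"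
    and inverts_ord_5: "\<And>y. y \<in> carrier G \<Longrightarrow> y \<notin> cyc (a \<otimes> z) \<Longrightarrow> ord y = 4 \<and> y \<otimes> a \<otimes> inv y = inv a"
proof -
  define c where "c = a \<otimes> z"
  have c: "c \<in> carrier G" using a z_closed by (simp add: c_def)
  have c10: "ord c = 10" using ord_mult_z[OF a] a5 by (simp add: c_def)
  have zc: "z \<in> cyc c" using z_in_cyc[OF c] c10 by simp
  have ac: "a \<in> cyc c" using cyc_mult_right[OF c zc a] cyc_self[of c] c_def by simp
  have ne: "cyc a \<noteq> cyc c" using card_cyc[OF a] card_cyc[OF c] a5 c10 by auto
  have four: "cyc y = cyc a \<or> cyc y = cyc c" if y: "y \<in> carrier G" and "ord y \<in> {5,8,10,12}" for y
  proof (rule ccontr)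
    assume "\<not> ?thesis"
    then have "cyc a \<noteq> cyc y" "cyc c \<noteq> cyc y" by metis+
    moreover have "ord a > 2" "ord c > 2" "ord y > 2" using a5 c10 that(2) by auto
    ultimately have "totient (ord a) + totient (ord c) + totient (ord y) \<le> 10"
      using totient_ord_three_le_10[OF a c y] ne by blast
    then show False using totient_ord_eq_4_iff[OF y] that(2) totient_5 totient_10 a5 c10 by simp
  qed
  have four_in: "y \<in> cyc c" if "y \<in> carrier G" and "ord y \<in> {5,8,10,12}" for y
    using four[OF that] cyc_self[of y] cyc_mono[OF c ac] by blast
  have cent: "y \<in> cyc c" if y: "y \<in> carrier G" and com: "y \<otimes> a = a \<otimes> y" for y
  proof (rule ccontr)
    assume ny: "y \<notin> cyc c"
    then have "ord y \<notin> {5,8,10,12}" using four_in[OF y] by blast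
    moreover have "ord y \<noteq> 1" using ny ord_eq_1[OF y] generate.one by metis
    moreover have "ord y \<noteq> 2" using ny involution_unique[OF y] zc by auto
    ultimately have oy: "ord y \<in> {3, 4, 6}" using ord_cases[OF y] by auto
    have ya: "w \<otimes> a = a \<otimes> w \<Longrightarrow> ord w \<notin> {3, 4}" if w: "w \<in> carrier G" for w
    proof
      assume com: "w \<otimes> a = a \<otimes> w" and ow: "ord w \<in> {3, 4}"
      have "coprime 3 (5::nat)" "coprime 4 (5::nat)" by code_simp+
      then have "ord (w \<otimes> a) = ord w * 5" using ord_mult_coprime[OF w a com] ow a5 by auto
      then have "ord (w \<otimes> a) = 15 \<or> ord (w \<otimes> a) = 20" using ow by auto
      then show False using ord_cases[of "w \<otimes> a"] w a by auto
    qed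
    \<comment> \<open>The remaining order 6 reduces to order 3 by passing to the square.\<close>
    have "ord y = 6" using ya[OF y com] oy by auto
    then have "ord (y [^] (2::nat)) = 3" using ord_pow[OF y, of 2] by simp
    moreover have "y [^] (2::nat) \<otimes> a = a \<otimes> y [^] (2::nat)"
      using pow_commute[OF y a com, of 2 1] a by simp
    ultimately show False using ya[of "y [^] (2::nat)"] y by simp
  qed
  then show "\<And>y. y \<in> carrier G \<Longrightarrow> y \<otimes> a = a \<otimes> y \<Longrightarrow> y \<in> cyc (a \<otimes> z)" unfolding c_def .
  fix y assume y: "y \<in> carrier G" and "y \<notin> cyc (a \<otimes> z)"
  then have ny: "y \<notin> cyc c" unfolding c_def by simp
  then have "ord y \<notin> {5,8,10,12}" using four_in[OF y] by blast
  moreover have "ord y \<noteq> 1" using ny ord_eq_1[OF y] generate.one by metis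
  moreover have "ord y \<noteq> 2" using ny involution_unique[OF y] zc by auto
  ultimately have oy: "ord y \<in> {3, 4, 6}" using ord_cases[OF y] by auto
  have nc: "y \<otimes> a \<otimes> inv y \<noteq> a" using ny cent[OF y] conj_eq_self_iff[OF y a] by blast
  let ?w = "y \<otimes> a \<otimes> inv y"
  have ow: "ord ?w = 5" using ord_conj[OF y a] a5 by simp
  then have "cyc ?w = cyc a \<or> cyc ?w = cyc c" using four[of ?w] y a by simp
  moreover have "cyc ?w \<noteq> cyc c" using card_cyc[of ?w] card_cyc[OF c] ow c10 y a by auto
  ultimately have "?w \<in> cyc a" using cyc_self[of ?w] by simp
  then obtain k :: nat where k: "?w = a [^] k" using mem_cyc_iff[OF a] by blast
  define r where "r = k mod 5"
  have r: "?w = a [^] r" "r < 5" using k pow_mod_ord[OF a, of k] a5 by (simp_all add: r_def)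
  have r1: "r \<noteq> 1" using nc r(1) a by auto
  \<comment> \<open>The elements \<open>\<one>\<close> and \<open>z\<close> centralize
    \<open>a\<close>, so the corresponding power of the action on \<open>cyc a\<close> is
    trivial.\<close>
  have pw: "r ^ j mod 5 = 1" if "y [^] j = \<one> \<or> y [^] j = z" for j :: nat
  proof -
    have "y [^] j \<otimes> a = a \<otimes> y [^] j" using that z_commutes[OF a] a by auto
    then have "a = a [^] (r ^ j)"
      using conj_iterate[OF y a r(1), of j] conj_eq_self_iff[of "y [^] j" a] y a by simp
    then have "a [^] int 1 = a [^] int (r ^ j)" using a by (simp only: int_pow_int) simp
    then have "int 5 dvd int (r ^ j) - int 1" unfolding int_pow_eq[OF a] a5 .
    then have "int (r ^ j) mod int 5 = int 1 mod int 5" by (simp only: mod_eq_dvd_iff)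
    then show ?thesis by (simp only: zmod_int[symmetric] of_nat_eq_iff) simp
  qed
  have rc: "r = 0 \<or> r = 1 \<or> r = 2 \<or> r = 3 \<or> r = 4" using r(2) by linarith
  \<comment> \<open>For orders 3 and 6 the cube of \<open>y\<close> is \<open>\<one>\<close> or
    \<open>z\<close>, but modulo 5 only 1 has cube 1. For order 4 the square is \<open>z\<close>, so
    \<open>r\<close> is a square root of 1 other than 1, namely 4.\<close>
  have "ord y \<noteq> 3"
    using pw[of 3] pow_ord_eq_1[OF y] rc r1 by auto
  moreover have "ord y \<noteq> 6"
    using pw[of 3] half_order[OF y, of 3] rc r1 by auto
  ultimately have y4: "ord y = 4" using oy by simp
  then have "r = 4" using pw[of 2] half_order[OF y, of 2] rc r1 by auto
  then have "?w = a [^] (4::nat)" using r by simp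
  moreover have "a [^] (4::nat) \<otimes> a = \<one>"
    using pow_ord_eq_1[OF a] nat_pow_Suc[of a 4] a5 by simp
  then have "inv a = a [^] (4::nat)" using a by (intro inv_equality) auto
  ultimately show "ord y = 4 \<and> y \<otimes> a \<otimes> inv y = inv a" using y4 by simp
qed

lemma iso_cases: "G \<cong> integer_mod_group 10 \<or> G \<cong> dicyclic_group_20"
proof -
  obtain a where a: "a \<in> carrier G" and a5: "ord a = 5" using exists_order_5 by blast
  define c where "c = a \<otimes> z"
  note cent = centralizer_ord_5[OF a a5, folded c_def] and invs = inverts_ord_5[OF a a5, folded c_def]
  have c: "c \<in> carrier G" using a z_closed by (simp add: c_def)
  have c10: "ord c = 10" using ord_mult_z[OF a] a5 by (simp add: c_def)
  show ?thesis
  proof (cases "carrier G = cyc c")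
    case True
    then have "order G = 10" using card_cyc[OF c] c10 by (simp add: order_def)
    then show ?thesis using cyclic_imp_iso_integer_mod_group[OF c True] by simp
  next
    case False
    then obtain b where b: "b \<in> carrier G" "b \<notin> cyc c" using cyc_in_carrier[OF c] by blast
    then have b4: "ord b = 4" and bab: "b \<otimes> a \<otimes> inv b = inv a" using invs by blast+
    \<comment> \<open>Both \<open>b\<close> and \<open>y\<close> invert \<open>a\<close>, so
      \<open>inv b \<otimes> y\<close> centralizes \<open>a\<close> and lies in
      \<open>cyc c\<close>. Thus \<open>G\<close> is covered by two cosets of a subgroup of order
      10.\<close>
    have cov: "\<exists>v \<in> cyc c. y = b \<otimes> v" if y: "y \<in> carrier G" "y \<notin> cyc c" for y
    proof -
      have swap: "p \<otimes> a = inv a \<otimes> p" if "p \<in> carrier G" "p \<otimes> a \<otimes> inv p = inv a" for p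
        using that a by (metis inv_closed inv_solve_right m_closed)
      have ya: "y \<otimes> a = inv a \<otimes> y" using swap y invs by blast
      have ba: "b \<otimes> a = inv a \<otimes> b" using swap b bab by blast
      have "inv b \<otimes> inv a = inv b \<otimes> (inv a \<otimes> b) \<otimes> inv b" using a b by (simp add: m_assoc)
      also have "\<dots> = inv b \<otimes> (b \<otimes> a) \<otimes> inv b" unfolding ba ..
      also have "\<dots> = a \<otimes> inv b" using a b by (simp add: m_assoc[symmetric])
      finally have ba': "inv b \<otimes> inv a = a \<otimes> inv b" .
      have "(inv b \<otimes> y) \<otimes> a = inv b \<otimes> (inv a \<otimes> y)" using a b y ya by (simp add: m_assoc)
      also have "\<dots> = (inv b \<otimes> inv a) \<otimes> y" using a b y by (simp add: m_assoc)
      also have "\<dots> = a \<otimes> (inv b \<otimes> y)" unfolding ba' using a b y by (simp add: m_assoc)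
      finally have "inv b \<otimes> y \<in> cyc c" using cent b y by simp
      moreover have "y = b \<otimes> (inv b \<otimes> y)" using b y by (simp add: m_assoc[symmetric])
      ultimately show ?thesis by blast
    qed
    then have sub: "carrier G \<subseteq> cyc c \<union> (\<lambda>v. b \<otimes> v) ` cyc c" by blast
    have "card (carrier G) \<le> card (cyc c \<union> (\<lambda>v. b \<otimes> v) ` cyc c)"
      by (rule card_mono[OF _ sub]) (simp add: finite_cyc c)
    also have "\<dots> \<le> card (cyc c) + card ((\<lambda>v. b \<otimes> v) ` cyc c)" by (rule card_Un_le)
    also have "\<dots> \<le> 20" using card_image_le[OF finite_cyc[OF c], of "\<lambda>v. b \<otimes> v"] card_cyc[OF c] c10 by simp
    finally have le: "order G \<le> 20" by (simp add: order_def)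
    have "5 dvd order G" "4 dvd order G"
      using ord_dvd_group_order[OF a] ord_dvd_group_order[OF b(1)] a5 b4 by simp_all
    moreover have "order G > 0" using order_gt_0_iff_finite finite_carrier by simp
    ultimately have o: "order G = 20" using le by presburger
    have "carrier G \<subseteq> H" if H: "subgroup H G" "a \<in> H" "b \<in> H" for H
    proof -
      \<comment> \<open>The involution is already the square of \<open>b\<close>, so
        \<open>a\<close> and \<open>b\<close> suffice to generate \<open>c\<close>.\<close>
      have "b [^] (2::nat) = z" using half_order[OF b(1), of 2] b4 by simp
      then have "b \<otimes> b = z" using b by (simp add: numeral_2_eq_2)
      then have "z \<in> H" using subgroup.m_closed[OF H(1) H(3) H(3)] by simp
      then have "c \<in> H" unfolding c_def by (rule subgroup.m_closed[OF H(1,2)])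
      then have "cyc c \<subseteq> H" using generate_subgroup_incl[OF _ H(1), of "{c}"] by simp
      then show ?thesis using sub subgroup.m_closed[OF H(1) H(3)] by blast
    qed
    then show ?thesis using iso_dicyclic_group_20[OF a b(1) a5 b4 bab _ o] by blast
  qed
qed

end

section \<open>The classification\<close>

context finite_group
begin

lemma iso_cases_if_one_involution:
  assumes c: "2 * card (cyclic_subgroups G) + 2 = order G" and t: "num_involutions G = 1"
  shows "G \<cong> integer_mod_group 10 \<or> G \<cong> dicyclic_group_20"
proof -
  obtain z where z: "{x \<in> carrier G. ord x = 2} = {z}"
    using t unfolding num_involutions_def by (rule card_1_singletonE)
  interpret unique_involution G z
  proof
    have "z \<in> {x \<in> carrier G. ord x = 2}" using z by simp
    then show "z \<in> carrier G" "ord z = 2" by simp_all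
    show "x = z" if "x \<in> carrier G" "ord x = 2" for x using that z by blast
    \<comment> \<open>With one involution there are \<open>card big_cyclic_subgroups + 2\<close>
      cyclic subgroups, and \<open>order G\<close> exceeds the sum of totients by 2; the hypothesis
      \<open>c\<close> links the two.\<close>
    show "(\<Sum>C\<in>big_cyclic_subgroups. totient (card C)) = 2 * card big_cyclic_subgroups + 4"
      using c t card_cyclic_subgroups order_eq_sum_totient by simp
  qed
  show ?thesis by (rule iso_cases)
qed

end

theorem theorem1p3:
  fixes G :: "('a, 'b) monoid_scheme"
  assumes "group G" and "finite (carrier G)"
    and "real (card (cyclic_subgroups G)) = real (order G) / 2 - 1"
  shows "(num_involutions G = 1 \<longleftrightarrow>
             G \<cong> integer_mod_group 10 \<or> G \<cong> dicyclic_group_20) \<and>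
         (real (num_involutions G) \<noteq> real (order G) / 2 - 2 \<and>
          real (num_involutions G) \<noteq> real (order G) / 2 - 3) \<and>
         (real (num_involutions G) = real (order G) / 2 - 4 \<longleftrightarrow>
             G \<cong> integer_mod_group 10)"
proof -
  interpret finite_group G using assms(1,2) by (simp add: finite_group_def finite_group_axioms_def)
  let ?t = "num_involutions G" and ?b = "card big_cyclic_subgroups"
  have c: "2 * card (cyclic_subgroups G) + 2 = order G" using assms(3) by linarith
  \<comment> \<open>This turns the prescribed values of \<open>?t\<close> in parts (2) and (3) into
    the values 0, 1 and 2 of \<open>?b\<close>.\<close>
  then have o: "order G = 2 * ?t + 2 * ?b + 4" using card_cyclic_subgroups by simp
  then have half: "real (order G) / 2 = real ?t + real ?b + 2" by (simp add: field_simps)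
  have sum: "order G = 1 + ?t + (\<Sum>C\<in>big_cyclic_subgroups. totient (card C))"
    by (rule order_eq_sum_totient)
  have "even (order G)" using o by simp
  \<comment> \<open>The totients of big subgroups are even, so in a group of even order 1 and the
    number of involutions have an even sum.\<close>
  then have t_odd: "odd ?t" using sum even_sum_totient_big by presburger
  have t10: "?t = 1" if "G \<cong> integer_mod_group 10"
    using num_involutions_iso[OF assms(1,2) group_integer_mod_group that]
      num_involutions_integer_mod_group_10 by simp
  have t20: "?t = 1" if "G \<cong> dicyclic_group_20"
    using num_involutions_iso[OF assms(1,2) group_dicyclic that]
      num_involutions_dicyclic_group_20 by simp
  have o10: "order G = 10" if "G \<cong> integer_mod_group 10"
    using iso_same_card[OF that] by (simp add: order_def carrier_integer_mod_group)
  have b0: "?b \<noteq> 0"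
  proof
    assume "?b = 0"
    then have "big_cyclic_subgroups = {}" using finite_big by simp
    then show False using sum o by simp
  qed
  have b1: "?b \<noteq> 1" using not_one_big o by fastforce
  have "G \<cong> integer_mod_group 10" if b: "?b = 2"
  proof -
    define k where "k = ?t + 4"
    have ok: "order G = 2 * k" using o b k_def by simp
    obtain w where w: "w \<in> carrier G" "ord w = order G"
      using two_big_imp_cyclic[OF b ok _ k_def] t_odd k_def by auto
    have gen: "carrier G = cyc w" by (rule generates_if_ord_eq_order[OF w])
    \<comment> \<open>A cyclic group of even order has at most one involution; parity makes it
      exactly one, and \<open>o\<close> with \<open>?b = 2\<close> gives order 10.\<close>
    have "?t \<le> 1" by (rule num_involutions_cyclic_le_1[OF w(1) gen ok])
    then have "?t = 1" using t_odd by (cases "?t") auto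
    then have "order G = 10" using o b by simp
    then show ?thesis using cyclic_imp_iso_integer_mod_group[OF w(1) gen] by simp
  qed
  moreover have "real ?t = real (order G) / 2 - 2 \<longleftrightarrow> ?b = 0"
    "real ?t = real (order G) / 2 - 3 \<longleftrightarrow> ?b = 1"
    "real ?t = real (order G) / 2 - 4 \<longleftrightarrow> ?b = 2"
    unfolding half by auto
  moreover have "?b = 2" if "G \<cong> integer_mod_group 10" using o t10[OF that] o10[OF that] by simp
  ultimately show ?thesis using b0 b1 t10 t20 iso_cases_if_one_involution[OF c] by metis
qed

end
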